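(* Assume $(A,B_2)$ and $(A,W^{1/2})$ are controllable and $(C_2,A)$ and $(Q^{1/2},A)$ are observable. Then for every $\gamma>0$ the strict sublevel set $\mathcal{L}_\gamma=\{K\in\mathcal{C}_{stab}: D_K=0,\ \|\mathbf{T}_{zw}\|_2^2<\gamma\}$ has at most two path-connected components. If it has two path-connected components $\mathcal{L}_\gamma^{(1)}$ and $\mathcal{L}_\gamma^{(2)}$, then they are diffeomorphic under the mapping $\mathscr{T}_T$ for any invertible $T\in\mathbb{R}^{n_x\times n_x}$ with $\det T<0$.
   Context: LQG setting: consider the continuous-time plant $\dot x=Ax+B_1w+B_2u$, $z=C_1x+D_{11}w+D_{12}u$, $y=C_2x+D_{21}w$ with $A\in\mathbb{R}^{n_x\times n_x}$, $B_2\in\mathbb{R}^{n_x\times n_u}$, $C_2\in\mathbb{R}^{n_y\times n_x}$, and, for given $W\succeq0$ ($n_x\times n_x$), $V\succ0$ ($n_y\times n_y$), $Q\succeq0$ ($n_x\times n_x$), $R\succ0$ ($n_u\times n_u$): $B_1=\begin{bmatrix}W^{1/2} & 0\end{bmatrix}$, $C_1=\begin{bmatrix}Q^{1/2}\\ 0\end{bmatrix}$, $D_{11}=0$, $D_{12}=\begin{bmatrix}0\\ R^{1/2}\end{bmatrix}$, $D_{21}=\begin{bmatrix}0 & V^{1/2}\end{bmatrix}$. A full-order controller $\dot\xi=A_K\xi+B_Ky$, $u=C_K\xi+D_Ky$, $\xi\in\mathbb{R}^{n_x}$, is identified with $K=\begin{bmatrix}D_K & C_K\\ B_K & A_K\end{bmatrix}$.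 Closed-loop matrices: $A_{cl}=\begin{bmatrix}A+B_2D_KC_2 & B_2C_K\\ B_KC_2 & A_K\end{bmatrix}$, $B_{cl}=\begin{bmatrix}B_1+B_2D_KD_{21}\\ B_KD_{21}\end{bmatrix}$, $C_{cl}=\begin{bmatrix}C_1+D_{12}D_KC_2 & D_{12}C_K\end{bmatrix}$, $D_{cl}=D_{11}+D_{12}D_KD_{21}$; $\mathcal{C}_{stab}$ is the set of $K$ with $A_{cl}$ Hurwitz; $\mathbf{T}_{zw}(s)=C_{cl}(sI-A_{cl})^{-1}B_{cl}+D_{cl}$ and $\|\cdot\|_2$ is the $\mathcal{H}_2$ norm. For invertible $T$, $\mathscr{T}_T(K)=\begin{bmatrix}D_K & C_KT^{-1}\\ TB_K & TA_KT^{-1}\end{bmatrix}$. *)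

theory Defs
  imports "HOL-Analysis.Analysis"
begin

definition hcat :: "real^'c1^'r \<Rightarrow> real^'c2^'r \<Rightarrow> real^('c1 + 'c2)^'r" where
  "hcat M N = (\<chi> i j. case j of Inl j1 \<Rightarrow> M $ i $ j1 | Inr j2 \<Rightarrow> N $ i $ j2)"

definition vcat :: "real^'c^'r1 \<Rightarrow> real^'c^'r2 \<Rightarrow> real^'c^('r1 + 'r2)" where
  "vcat M N = (\<chi> i j. case i of Inl i1 \<Rightarrow> M $ i1 $ j | Inr i2 \<Rightarrow> N $ i2 $ j)"

definition blk :: "real^'c1^'r1 \<Rightarrow> real^'c2^'r1 \<Rightarrow> real^'c1^'r2 \<Rightarrow> real^'c2^'r2
                    \<Rightarrow> real^('c1 + 'c2)^('r1 + 'r2)" where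
  "blk M11 M12 M21 M22 = vcat (hcat M11 M12) (hcat M21 M22)"

definition matpow :: "real^'n^'n \<Rightarrow> nat \<Rightarrow> real^'n^'n" where
  "matpow M k = ((\<lambda>X. M ** X) ^^ k) (mat 1)"

definition psd :: "real^'n^'n \<Rightarrow> bool" where
  "psd M \<longleftrightarrow> transpose M = M \<and> (\<forall>x. 0 \<le> x \<bullet> (M *v x))"

definition pd :: "real^'n^'n \<Rightarrow> bool" where
  "pd M \<longleftrightarrow> transpose M = M \<and> (\<forall>x. x \<noteq> 0 \<longrightarrow> 0 < x \<bullet> (M *v x))"

definition msqrt :: "real^'n^'n \<Rightarrow> real^'n^'n" where
  "msqrt M = (THE S. psd S \<and> S ** S = M)"

definition cmat :: "real^'c^'r \<Rightarrow> complex^'c^'r" where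
  "cmat M = (\<chi> i j. complex_of_real (M $ i $ j))"

text \<open>Kalman rank conditions: rank [B, AB, ..., A^(n-1) B] = n, i.e. the columns span R^n.\<close>
definition controllable :: "real^'n^'n \<Rightarrow> real^'m^'n \<Rightarrow> bool" where
  "controllable A B \<longleftrightarrow>
     span {column j (matpow A k ** B) | k j. k < CARD('n)} = (UNIV :: (real^'n) set)"

text \<open>rank [C; CA; ...; CA^(n-1)] = n, i.e. the rows span R^n.\<close>
definition observable :: "real^'n^'p \<Rightarrow> real^'n^'n \<Rightarrow> bool" where
  "observable C A \<longleftrightarrow>
     span {row i (C ** matpow A k) | k i. k < CARD('n)} = (UNIV :: (real^'n) set)"

definition hurwitz :: "real^'n^'n \<Rightarrow> bool" where
  "hurwitz M \<longleftrightarrow> (\<forall>(lam::complex) v. v \<noteq> 0 \<and> cmat M *v v = lam *s v \<longrightarrow> Re lam < 0)"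

definition tf_jw :: "real^'n^'n \<Rightarrow> real^'w^'n \<Rightarrow> real^'n^'z \<Rightarrow> real^'w^'z \<Rightarrow> real
                     \<Rightarrow> complex^'w^'z" where
  "tf_jw Acl Bcl Ccl Dcl \<omega> =
     cmat Ccl ** matrix_inv (mat (\<i> * complex_of_real \<omega>) - cmat Acl) ** cmat Bcl + cmat Dcl"

text \<open>Squared H2 norm: (1/2pi) int trace(T(i w)^* T(i w)) dw  (value in [0,\<infinity>]).\<close>
definition h2sq :: "real^'n^'n \<Rightarrow> real^'w^'n \<Rightarrow> real^'n^'z \<Rightarrow> real^'w^'z \<Rightarrow> ennreal" where
  "h2sq Acl Bcl Ccl Dcl =
     ennreal (1 / (2 * pi)) *
     (\<integral>\<^sup>+ \<omega>. ennreal (\<Sum>i\<in>UNIV. \<Sum>j\<in>UNIV. (cmod (tf_jw Acl Bcl Ccl Dcl \<omega> $ i $ j))\<^sup>2) \<partial>lborel)"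

definition DKof :: "real^(('y::finite) + ('n::finite))^(('u::finite) + ('n::finite)) \<Rightarrow> real^('y::finite)^('u::finite)" where
  "DKof K = (\<chi> i j. K $ Inl i $ Inl j)"
definition CKof :: "real^(('y::finite) + ('n::finite))^(('u::finite) + ('n::finite)) \<Rightarrow> real^('n::finite)^('u::finite)" where
  "CKof K = (\<chi> i j. K $ Inl i $ Inr j)"
definition BKof :: "real^(('y::finite) + ('n::finite))^(('u::finite) + ('n::finite)) \<Rightarrow> real^('y::finite)^('n::finite)" where
  "BKof K = (\<chi> i j. K $ Inr i $ Inl j)"
definition AKof :: "real^(('y::finite) + ('n::finite))^(('u::finite) + ('n::finite)) \<Rightarrow> real^('n::finite)^('n::finite)" where
  "AKof K = (\<chi> i j. K $ Inr i $ Inr j)"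

definition B1of :: "real^('n::finite)^('n::finite) \<Rightarrow> real^('y::finite)^('y::finite) \<Rightarrow> real^(('n::finite) + ('y::finite))^('n::finite)" where
  "B1of W V = hcat (msqrt W) (0 :: real^'y^'n)"
definition C1of :: "real^('n::finite)^('n::finite) \<Rightarrow> real^('u::finite)^('u::finite) \<Rightarrow> real^('n::finite)^(('n::finite) + ('u::finite))" where
  "C1of Q R = vcat (msqrt Q) (0 :: real^'n^'u)"
definition D11of :: "real^('n::finite)^('n::finite) \<Rightarrow> real^('y::finite)^('y::finite) \<Rightarrow> real^('u::finite)^('u::finite) \<Rightarrow> real^(('n::finite) + ('y::finite))^(('n::finite) + ('u::finite))" where
  "D11of W V R = 0"
definition D12of :: "real^('n::finite)^('n::finite) \<Rightarrow> real^('u::finite)^('u::finite) \<Rightarrow> real^('u::finite)^(('n::finite) + ('u::finite))" where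
  "D12of Q R = vcat (0 :: real^'u^'n) (msqrt R)"
definition D21of :: "real^('n::finite)^('n::finite) \<Rightarrow> real^('y::finite)^('y::finite) \<Rightarrow> real^(('n::finite) + ('y::finite))^('y::finite)" where
  "D21of W V = hcat (0 :: real^'n^'y) (msqrt V)"

definition Acl :: "real^('n::finite)^('n::finite) \<Rightarrow> real^('u::finite)^('n::finite) \<Rightarrow> real^('n::finite)^('y::finite) \<Rightarrow> real^(('y::finite) + ('n::finite))^(('u::finite) + ('n::finite))
                   \<Rightarrow> real^(('n::finite) + ('n::finite))^(('n::finite) + ('n::finite))" where
  "Acl A B2 C2 K = blk (A + B2 ** DKof K ** C2) (B2 ** CKof K) (BKof K ** C2) (AKof K)"

definition Bcl :: "real^('u::finite)^('n::finite) \<Rightarrow> real^(('n::finite) + ('y::finite))^('n::finite) \<Rightarrow> real^(('n::finite) + ('y::finite))^('y::finite) \<Rightarrow> real^(('y::finite) + ('n::finite))^(('u::finite) + ('n::finite))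
                   \<Rightarrow> real^(('n::finite) + ('y::finite))^(('n::finite) + ('n::finite))" where
  "Bcl B2 B1 D21 K = vcat (B1 + B2 ** DKof K ** D21) (BKof K ** D21)"

definition Ccl :: "real^('n::finite)^('z::finite) \<Rightarrow> real^('u::finite)^('z::finite) \<Rightarrow> real^('n::finite)^('y::finite) \<Rightarrow> real^(('y::finite) + ('n::finite))^(('u::finite) + ('n::finite))
                   \<Rightarrow> real^(('n::finite) + ('n::finite))^('z::finite)" where
  "Ccl C1 D12 C2 K = hcat (C1 + D12 ** DKof K ** C2) (D12 ** CKof K)"

definition Dcl :: "real^('w::finite)^('z::finite) \<Rightarrow> real^('u::finite)^('z::finite) \<Rightarrow> real^('w::finite)^('y::finite) \<Rightarrow> real^(('y::finite) + ('n::finite))^(('u::finite) + ('n::finite))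
                   \<Rightarrow> real^('w::finite)^('z::finite)" where
  "Dcl D11 D12 D21 K = D11 + D12 ** DKof K ** D21"

definition lqg_h2sq :: "real^('n::finite)^('n::finite) \<Rightarrow> real^('u::finite)^('n::finite) \<Rightarrow> real^('n::finite)^('y::finite) \<Rightarrow> real^('n::finite)^('n::finite) \<Rightarrow> real^('y::finite)^('y::finite)
                        \<Rightarrow> real^('n::finite)^('n::finite) \<Rightarrow> real^('u::finite)^('u::finite) \<Rightarrow> real^(('y::finite) + ('n::finite))^(('u::finite) + ('n::finite)) \<Rightarrow> ennreal" where
  "lqg_h2sq A B2 C2 W V Q R K =
     h2sq (Acl A B2 C2 K) (Bcl B2 (B1of W V) (D21of W V) K)
          (Ccl (C1of Q R) (D12of Q R) C2 K) (Dcl (D11of W V R) (D12of Q R) (D21of W V) K)"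

definition Cstab :: "real^('n::finite)^('n::finite) \<Rightarrow> real^('u::finite)^('n::finite) \<Rightarrow> real^('n::finite)^('y::finite) \<Rightarrow> (real^(('y::finite) + ('n::finite))^(('u::finite) + ('n::finite))) set" where
  "Cstab A B2 C2 = {K. hurwitz (Acl A B2 C2 K)}"

definition sublevel :: "real^('n::finite)^('n::finite) \<Rightarrow> real^('u::finite)^('n::finite) \<Rightarrow> real^('n::finite)^('y::finite) \<Rightarrow> real^('n::finite)^('n::finite) \<Rightarrow> real^('y::finite)^('y::finite)
                        \<Rightarrow> real^('n::finite)^('n::finite) \<Rightarrow> real^('u::finite)^('u::finite) \<Rightarrow> real \<Rightarrow> (real^(('y::finite) + ('n::finite))^(('u::finite) + ('n::finite))) set" where
  "sublevel A B2 C2 W V Q R \<gamma> =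
     {K \<in> Cstab A B2 C2. DKof K = 0 \<and> lqg_h2sq A B2 C2 W V Q R K < ennreal \<gamma>}"

definition simT :: "real^('n::finite)^('n::finite) \<Rightarrow> real^(('y::finite) + ('n::finite))^(('u::finite) + ('n::finite)) \<Rightarrow> real^(('y::finite) + ('n::finite))^(('u::finite) + ('n::finite))" where
  "simT T K = blk (DKof K) (CKof K ** matrix_inv T) (T ** BKof K) (T ** AKof K ** matrix_inv T)"

fun dder :: "'a::real_normed_vector list \<Rightarrow> ('a \<Rightarrow> 'b::real_normed_vector) \<Rightarrow> 'a \<Rightarrow> 'b" where
  "dder [] f = f"
| "dder (v # vs) f = (\<lambda>x. frechet_derivative (dder vs f) (at x) v)"

definition smooth_on :: "'a::real_normed_vector set \<Rightarrow> ('a \<Rightarrow> 'b::real_normed_vector) \<Rightarrow> bool" where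
  "smooth_on S f \<longleftrightarrow> (\<forall>vs. \<forall>x\<in>S. dder vs f differentiable (at x))"

definition diffeo_via :: "('a::real_normed_vector \<Rightarrow> 'b::real_normed_vector) \<Rightarrow> 'a set \<Rightarrow> 'b set \<Rightarrow> bool" where
  "diffeo_via f S S' \<longleftrightarrow> (\<exists>g. homeomorphism S S' f g \<and> smooth_on S f \<and> smooth_on S' g)"

end

theory Submission
  imports Defs "HOL-Complex_Analysis.Cauchy_Integral_Theorem"
begin

text \<open>
  A controller with \<open>D\<^sub>K = 0\<close> lies in the sublevel set iff some \<open>P \<succ> 0\<close> satisfies the strict
  Lyapunov inequality \<open>A\<^sub>c\<^sub>l P + P A\<^sub>c\<^sub>l\<^sup>T + B\<^sub>c\<^sub>l B\<^sub>c\<^sub>l\<^sup>T \<prec> 0\<close> with \<open>tr (C\<^sub>c\<^sub>l P C\<^sub>c\<^sub>l\<^sup>T) < \<gamma>\<close>.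
  Strictness allows perturbing \<open>P\<close> so that its off-diagonal block is invertible, and then a
  similarity of the controller state brings \<open>P\<close> to the shape \<open>[X Z; Z Z]\<close>. Controllers with a certificate of this
  shape are a continuous image of a convex set (Scherer's linearizing change of variables), hence
  path-connected. So the sublevel set is a continuous image of \<open>GL\<^sub>n\<close> times a path-connected set,
  and \<open>GL\<^sub>n\<close> has two path components, told apart by the sign of the determinant.
  The inequality is linked to the frequency integral
  through \<open>R P + P R\<^sup>* = - R (A P + P A\<^sup>T) R\<^sup>*\<close> for \<open>R = (\<i>\<omega> - A)\<^sup>-\<^sup>1\<close>; the principal value
  of \<open>\<integral> R d\<omega>\<close> is \<open>\<pi> I\<close> when \<open>A\<close> is Hurwitz.
\<close>

section \<open>Inverse matrices and the general linear group\<close>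

text \<open>The exact Gramian of a closed loop may be singular or have a singular off-diagonal
  block, so it cannot be normalized as it stands; solutions of the strict inequality form an open
  set and leave room to move. If M and Z are the off-diagonal and lower right blocks of a
  certificate, the coordinate change T = M Z^-1 produces the special shape, so up to the choice of T
  every controller comes from one path-connected family. The set is thus covered by two
  path-connected halves, one for each sign of det T. They may overlap, or be empty when no
  controller reaches the level, whence "at most two". If there are two components, they are the
  halves themselves, and a coordinate change of negative determinant exchanges them. A single
  principal value carries the analysis: it shows that the Lyapunov operator is injective, hence onto
  in finite dimension, that its solutions are semidefinite, and what the frequency integral equals.
  No matrix exponential occurs.\<close>

lemma matrix_inv_right:
  fixes A :: "'a::field^'n^'n"
  assumes "det A \<noteq> 0" shows "A ** matrix_inv A = mat 1"
proof -
  obtain B where "A ** B = mat 1" "B ** A = mat 1"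
    using assms unfolding invertible_det_nz[symmetric] invertible_def by blast
  then have "A ** matrix_inv A = mat 1 \<and> matrix_inv A ** A = mat 1"
    unfolding matrix_inv_def by (intro someI[where P = "\<lambda>B. A ** B = mat 1 \<and> B ** A = mat 1" and x = B] conjI)
  then show ?thesis by blast
qed

lemma matrix_inv_left:
  fixes A :: "'a::field^'n^'n"
  assumes "det A \<noteq> 0" shows "matrix_inv A ** A = mat 1"
  using matrix_inv_right[OF assms] matrix_left_right_inverse by blast

lemma matrix_inv_unique_right:
  fixes A :: "'a::field^'n^'n"
  assumes "A ** B = mat 1" shows "matrix_inv A = B" "det A \<noteq> 0"
proof -
  have "det A * det B = 1"
    using arg_cong[OF assms, of det] by (simp add: det_mul)
  then show d: "det A \<noteq> 0" by auto
  have "matrix_inv A = matrix_inv A ** (A ** B)" by (simp add: assms)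
  also have "\<dots> = B" by (simp add: matrix_mul_assoc matrix_inv_left[OF d])
  finally show "matrix_inv A = B" .
qed

lemma det_nz_if_inj:
  fixes A :: "'a::field^'n^'n"
  assumes "\<And>x. A *v x = 0 \<Longrightarrow> x = 0" shows "det A \<noteq> 0"
  unfolding invertible_det_nz[symmetric] invertible_left_inverse matrix_left_invertible_ker
  using assms by blast

lemma cramer_component:
  fixes A :: "'a::field^'n^'n"
  assumes "det A \<noteq> 0"
  shows "A *v x = b \<longleftrightarrow> (\<forall>k. x $ k = det (\<chi> i j. if j = k then b $ i else A $ i $ j) / det A)"
  using cramer[OF assms, of x b] by (simp add: vec_eq_iff)

text \<open>Cramer's rule exhibits the entries of the inverse as quotients of determinants, which
  reduces continuity of inversion to that of polynomials.\<close>

lemma matrix_inv_component: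
  fixes A :: "'a::field^'n^'n"
  assumes "det A \<noteq> 0"
  shows "matrix_inv A $ k $ l = det (\<chi> i j. if j = k then mat 1 $ i $ l else A $ i $ j) / det A"
proof -
  have "A *v column l (matrix_inv A) = column l (mat 1)"
    by (simp add: vec_eq_iff matrix_vector_mult_def column_def)
       (simp add: matrix_inv_right[OF assms, symmetric] matrix_matrix_mult_def)
  then have "column l (matrix_inv A) $ k =
      det (\<chi> i j. if j = k then column l (mat 1) $ i else A $ i $ j) / det A"
    using cramer_component[OF assms] by blast
  moreover have "(column l (mat 1) :: 'a^'n) $ i = mat 1 $ i $ l" for i
    by (simp add: column_def)
  ultimately show ?thesis by (simp add: column_def cong: if_cong)
qed

lemma continuous_on_matrixI:
  fixes f :: "'a::topological_space \<Rightarrow> 'b::topological_space^'n^'m"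
  assumes "\<And>i j. continuous_on S (\<lambda>x. f x $ i $ j)"
  shows "continuous_on S f"
proof -
  have "continuous_on S (\<lambda>x. \<chi> i j. f x $ i $ j)"
    by (intro continuous_on_vec_lambda assms)
  then show ?thesis by simp
qed

lemma continuous_on_det [continuous_intros]:
  fixes f :: "'a::topological_space \<Rightarrow> 'b::{real_normed_field}^'n^'n"
  assumes "continuous_on S f" shows "continuous_on S (\<lambda>x. det (f x))"
  unfolding det_def by (intro continuous_intros assms)

lemma continuous_on_matrix_inv [continuous_intros]:
  fixes f :: "'a::topological_space \<Rightarrow> 'b::{real_normed_field}^'n^'n"
  assumes f: "continuous_on S f" and nz: "\<And>x. x \<in> S \<Longrightarrow> det (f x) \<noteq> 0"
  shows "continuous_on S (\<lambda>x. matrix_inv (f x))"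
proof (rule continuous_on_matrixI)
  fix k l
  have "continuous_on S (\<lambda>x. det (\<chi> i j. if j = k then mat 1 $ i $ l else f x $ i $ j) / det (f x))"
  proof (intro continuous_intros f)
    show "continuous_on S (\<lambda>x. if j = k then mat 1 $ i $ l else f x $ i $ j)" for i j
      by (cases "j = k") (auto intro!: continuous_intros f)
  qed (use nz in simp)
  then show "continuous_on S (\<lambda>x. matrix_inv (f x) $ k $ l)"
    by (rule continuous_on_eq) (simp add: matrix_inv_component nz)
qed

lemma continuous_on_matrix_matrix_mult [continuous_intros]:
  fixes f :: "'a::topological_space \<Rightarrow> 'b::{real_normed_algebra_1}^'n^'m"
  assumes "continuous_on S f" "continuous_on S g"
  shows "continuous_on S (\<lambda>x. f x ** g x)"
  unfolding matrix_matrix_mult_def by (intro continuous_intros assms)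

section \<open>Path components of the invertible real matrices\<close>

definition gl_connected :: "real^'n^'n \<Rightarrow> real^'n^'n \<Rightarrow> bool" where
  "gl_connected = path_component {M. det M \<noteq> 0}"

lemma gl_connected_segment:
  assumes "\<And>t. 0 \<le> t \<Longrightarrow> t \<le> 1 \<Longrightarrow> det ((1 - t) *\<^sub>R M + t *\<^sub>R N) \<noteq> 0"
  shows "gl_connected M N"
  unfolding gl_connected_def path_component_def
  by (rule exI[of _ "linepath M N"]) (use assms in \<open>auto simp: in_segment\<close>)

lemma gl_connected_trans: "gl_connected L M \<Longrightarrow> gl_connected M N \<Longrightarrow> gl_connected L N"
  unfolding gl_connected_def by (rule path_component_trans)

lemma gl_connected_sym: "gl_connected L M \<Longrightarrow> gl_connected M L"
  unfolding gl_connected_def by (rule path_component_sym)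

lemma gl_connected_mult:
  assumes "gl_connected L M" "gl_connected L' M'"
  shows "gl_connected (L ** L') (M ** M')"
proof -
  obtain g h where g: "path g" "path_image g \<subseteq> {M. det M \<noteq> 0}" "pathstart g = L" "pathfinish g = M"
    and h: "path h" "path_image h \<subseteq> {M. det M \<noteq> 0}" "pathstart h = L'" "pathfinish h = M'"
    using assms unfolding gl_connected_def path_component_def by auto
  show ?thesis
    unfolding gl_connected_def path_component_def
    using g h
    by (intro exI[of _ "\<lambda>t. g t ** h t"])
       (auto simp: path_def path_image_def pathstart_def pathfinish_def det_mul image_subset_iff
             intro!: continuous_intros)
qed

definition diag_refl :: "'n \<Rightarrow> real^'n^'n" where
  "diag_refl k = (\<chi> i j. if i = j then if i = k then - 1 else 1 else 0)"

lemma det_diag_refl: "det (diag_refl k) = - 1"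
proof -
  have "det (diag_refl k) = (\<Prod>i\<in>UNIV. diag_refl k $ i $ i)"
    by (rule det_diagonal) (simp add: diag_refl_def)
  also have "\<dots> = (\<Prod>i\<in>UNIV. if i = k then - 1 else 1)"
    by (simp add: diag_refl_def)
  finally show ?thesis by simp
qed

lemma diag_refl_mult: "(diag_refl k ** M) $ i $ j = (if i = k then - (M $ i $ j) else M $ i $ j)"
proof -
  have "(diag_refl k ** M) $ i $ j = (\<Sum>l\<in>UNIV. diag_refl k $ i $ l * M $ l $ j)"
    by (simp add: matrix_matrix_mult_def)
  also have "\<dots> = (\<Sum>l\<in>UNIV. if l = i then if i = k then - (M $ i $ j) else M $ i $ j else 0)"
    by (rule sum.cong) (auto simp: diag_refl_def)
  finally show ?thesis by simp
qed

lemma diag_refl_mult_vec: "(diag_refl k *v x) $ i = (if i = k then - (x $ i) else x $ i)"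
proof -
  have "(diag_refl k *v x) $ i = (\<Sum>l\<in>UNIV. diag_refl k $ i $ l * x $ l)"
    by (simp add: matrix_vector_mult_def)
  also have "\<dots> = (\<Sum>l\<in>UNIV. if l = i then if i = k then - (x $ i) else x $ i else 0)"
    by (rule sum.cong) (auto simp: diag_refl_def)
  finally show ?thesis by simp
qed

lemma diag_refl_involution: "diag_refl k ** diag_refl k = mat 1"
  by (simp add: vec_eq_iff diag_refl_mult) (auto simp: diag_refl_def mat_def)

text \<open>Both endpoints are the identity off the plane of coordinates \<open>m\<close> and
  \<open>n\<close> and reflections within it. There the segment is [t, 1-t; 1-t, -t], whose
  determinant -(t^2 + (1-t)^2) never vanishes.\<close>

lemma gl_connected_swap_diag_refl:
  fixes m n :: "'n::finite"
  assumes "m \<noteq> n"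
  shows "gl_connected (\<chi> i j. mat 1 $ i $ Transposition.transpose m n j) (diag_refl n)"
proof (rule gl_connected_segment)
  fix t :: real assume t: "0 \<le> t" "t \<le> 1"
  let ?S = "(\<chi> i j. mat 1 $ i $ Transposition.transpose m n j) :: real^'n^'n"
  have S: "(?S *v x) $ i = x $ Transposition.transpose m n i" for x i
  proof -
    have "(?S *v x) $ i = (\<Sum>j\<in>UNIV. ?S $ i $ j * x $ j)"
      by (simp add: matrix_vector_mult_def)
    also have "\<dots> = (\<Sum>j\<in>UNIV. if j = Transposition.transpose m n i then x $ j else 0)"
      by (rule sum.cong) (auto simp: mat_def)
    finally show ?thesis by simp
  qed
  have D: "(diag_refl n *v x) $ i = (if i = n then - x $ i else x $ i)" for x i
    by (rule diag_refl_mult_vec)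
  show "det ((1 - t) *\<^sub>R ?S + t *\<^sub>R diag_refl n) \<noteq> 0"
  proof (rule det_nz_if_inj)
    fix x assume "((1 - t) *\<^sub>R ?S + t *\<^sub>R diag_refl n) *v x = 0"
    then have *: "(1 - t) * x $ Transposition.transpose m n i + t * (if i = n then - x $ i else x $ i) = 0" for i
      by (simp add: vec_eq_iff matrix_vector_mult_add_rdistrib scaleR_matrix_vector_assoc[symmetric] S D
          del: vector_transpose_matrix)
    have 1: "x $ i = 0" if "i \<noteq> m" "i \<noteq> n" for i
      using *[of i] that by (simp add: algebra_simps)
    have 2: "(1 - t) * x $ n + t * x $ m = 0" "(1 - t) * x $ m - t * x $ n = 0"
      using *[of m] *[of n] assms by auto
    have "((1 - t)\<^sup>2 + t\<^sup>2) * x $ n = (1 - t) * ((1 - t) * x $ n + t * x $ m) - t * ((1 - t) * x $ m - t * x $ n)"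
      "((1 - t)\<^sup>2 + t\<^sup>2) * x $ m = t * ((1 - t) * x $ n + t * x $ m) + (1 - t) * ((1 - t) * x $ m - t * x $ n)"
      by (simp_all add: algebra_simps power2_eq_square)
    moreover have "(1 - t)\<^sup>2 + t\<^sup>2 \<noteq> 0"
      by (simp add: sum_power2_eq_zero_iff)
    ultimately have "x $ n = 0" "x $ m = 0" unfolding 2 by (metis mult_zero_right add_0 diff_zero mult_eq_0_iff)+
    then show "x = 0" using 1 by (metis vec_eq_iff zero_index)
  qed
qed

lemma gl_connected_refl: "det M \<noteq> 0 \<Longrightarrow> gl_connected M M"
  unfolding gl_connected_def by (simp add: path_component_refl)

text \<open>Two different reflections are both joined to the same swap matrix.\<close>

lemma gl_connected_diag_refl: "gl_connected (diag_refl m) (diag_refl n)"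
proof (cases "m = n")
  case True then show ?thesis by (simp add: gl_connected_refl det_diag_refl)
next
  case False
  have "Transposition.transpose m n = Transposition.transpose n m"
    by (simp add: transpose_commute)
  then show ?thesis
    using gl_connected_trans[OF gl_connected_sym[OF gl_connected_swap_diag_refl[OF False[symmetric]]]]
      gl_connected_swap_diag_refl[OF False] by simp
qed

text \<open>Each sign flip can be moved to coordinate \<open>k\<close>, where two flips cancel, so
  only the parity of \<open>F\<close> matters.\<close>

lemma gl_connected_signs:
  fixes F :: "'n::finite set"
  assumes "finite F"
  shows "gl_connected (\<chi> i j. if i = j then if i \<in> F then - 1 else 1 else 0) (mat 1) \<or>
         gl_connected (\<chi> i j. if i = j then if i \<in> F then - 1 else 1 else 0) (diag_refl k)"
  using assms
proof (induction F rule: finite_induct)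
  case empty
  have "(\<chi> i j. if i = j then if i \<in> {} then - 1 else 1 else 0) = (mat 1 :: real^'n^'n)"
    by (simp add: mat_def vec_eq_iff)
  then show ?case by (metis gl_connected_refl det_I one_neq_zero)
next
  case (insert a F)
  let ?D = "\<lambda>F. (\<chi> i j. if i = j then if i \<in> F then - 1 else 1 else 0) :: real^'n^'n"
  have e: "?D (insert a F) = diag_refl a ** ?D F"
    using insert by (simp add: vec_eq_iff diag_refl_mult)
  have "gl_connected (diag_refl a ** ?D F) (diag_refl k ** mat 1) \<or>
        gl_connected (diag_refl a ** ?D F) (diag_refl k ** diag_refl k)"
    using insert.IH by (rule disj_forward) (rule gl_connected_mult[OF gl_connected_diag_refl], assumption)+
  then show ?case
    unfolding e by (simp add: diag_refl_involution)
      blast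
qed

text \<open>Elementary matrices generate, and the two classes multiply among themselves because
  \<open>diag_refl k\<close> is an involution.\<close>

lemma gl_connected_mat_1_or_diag_refl:
  fixes M :: "real^'n^'n"
  shows "det M \<noteq> 0 \<Longrightarrow> gl_connected M (mat 1) \<or> gl_connected M (diag_refl k)"
proof (induction M rule: induct_matrix_elementary)
  case (1 A B)
  then have "gl_connected A (mat 1) \<or> gl_connected A (diag_refl k)"
    "gl_connected B (mat 1) \<or> gl_connected B (diag_refl k)"
    by (auto simp: det_mul)
  then show ?case
    using gl_connected_mult[of A "mat 1" B "mat 1"] gl_connected_mult[of A "mat 1" B "diag_refl k"]
      gl_connected_mult[of A "diag_refl k" B "mat 1"] gl_connected_mult[of A "diag_refl k" B "diag_refl k"]
    unfolding diag_refl_involution matrix_mul_lid matrix_mul_rid by blast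
next
  case (2 A i)
  then show ?case using det_zero_row(1)[of i A] by simp
next
  case (3 A)
  have nz: "A $ i $ i \<noteq> 0" for i
    using 3(2) det_diagonal[of A, OF 3(1)] by auto
  \<comment> \<open>Moving each diagonal entry straight to its sign never crosses zero.\<close>
  let ?D = "(\<chi> i j. if i = j then if i \<in> {i. A $ i $ i < 0} then - 1 else 1 else 0) :: real^'n^'n"
  have "gl_connected A ?D"
  proof (rule gl_connected_segment)
    fix t :: real assume t: "0 \<le> t" "t \<le> 1"
    let ?M = "(1 - t) *\<^sub>R A + t *\<^sub>R ?D"
    have "?M $ i $ i \<noteq> 0" for i
    proof (cases "A $ i $ i < 0")
      case True
      have "(1 - t) * A $ i $ i - t < 0"
        using True t by (cases "t = 1") (use mult_pos_neg[of "1 - t" "A $ i $ i"] in auto)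
      then show ?thesis using True by simp
    next
      case False
      then have "A $ i $ i > 0" using nz[of i] by simp
      then have "(1 - t) * A $ i $ i + t > 0"
        using t by (cases "t = 1") (auto intro: add_pos_nonneg)
      then show ?thesis using False by simp
    qed
    moreover have "det ?M = (\<Prod>i\<in>UNIV. ?M $ i $ i)"
      by (rule det_diagonal) (simp add: 3(1))
    ultimately show "det ?M \<noteq> 0" by simp
  qed
  then show ?case
    by (intro disj_forward[OF gl_connected_signs[of "{i. A $ i $ i < 0}" k, OF finite]]) (rule gl_connected_trans[of A ?D], assumption+)+
next
  case (4 m n)
  then show ?case
    by (intro disjI2 gl_connected_trans[OF gl_connected_swap_diag_refl gl_connected_diag_refl])
next
  case (5 m n c)
  \<comment> \<open>A shear shrinks to the identity by scaling its single off-diagonal entry; its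
    kernel is trivial for every \<open>c\<close>.\<close>
  let ?E = "\<lambda>c. (\<chi> i j. if i = m \<and> j = n then c else of_bool (i = j)) :: real^'n^'n"
  have inj: "det (?E c) \<noteq> 0" for c
  proof (rule det_nz_if_inj)
    fix x assume x: "?E c *v x = 0"
    have i: "x $ i = 0" if "i \<noteq> m" for i
    proof -
      have "(?E c *v x) $ i = (\<Sum>j\<in>UNIV. if j = i then x $ i else 0)"
        unfolding matrix_vector_mult_def using that by (auto intro!: sum.cong)
      then show ?thesis using x by simp
    qed
    have "(?E c *v x) $ m = (\<Sum>j\<in>UNIV. ?E c $ m $ j * x $ j)"
      by (simp add: matrix_vector_mult_def)
    also have "\<dots> = (\<Sum>j\<in>UNIV. if j = m then x $ m else 0)"
      using i 5(1) by (intro sum.cong) auto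
    finally have "x $ m = 0" using x by simp
    then show "x = 0" using i by (metis vec_eq_iff zero_index)
  qed
  have "gl_connected (?E c) (?E 0)"
  proof (rule gl_connected_segment)
    fix t :: real
    have "(1 - t) *\<^sub>R ?E c + t *\<^sub>R ?E 0 = ?E ((1 - t) * c)"
      by (simp add: vec_eq_iff algebra_simps)
    then show "det ((1 - t) *\<^sub>R ?E c + t *\<^sub>R ?E 0) \<noteq> 0" using inj by simp
  qed
  moreover have "?E 0 = mat 1"
    using 5(1) by (auto simp: vec_eq_iff mat_def)
  ultimately show ?case by simp
qed

lemma gl_connected_sgn_det:
  assumes "gl_connected M N" shows "0 < det M * det N"
proof (rule ccontr)
  assume neg: "\<not> ?thesis"
  obtain g where g: "path g" "path_image g \<subseteq> {M. det M \<noteq> 0}" "pathstart g = M" "pathfinish g = N"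
    using assms unfolding gl_connected_def path_component_def by auto
  let ?D = "(\<lambda>t. det (g t)) ` {0..1}"
  have "connected ((\<lambda>t. det (g t)) ` {0..1})"
    using g(1) by (intro connected_continuous_image continuous_intros) (auto simp: path_def)
  moreover have "0 \<notin> (\<lambda>t. det (g t)) ` {0..1}" using g(2) by (auto simp: path_image_def)
  moreover have MN: "det M \<in> (\<lambda>t. det (g t)) ` {0..1}" "det N \<in> (\<lambda>t. det (g t)) ` {0..1}"
    using g(3,4) by (force simp: pathstart_def pathfinish_def)+
  ultimately have c: "\<And>x y z. x \<in> ?D \<Longrightarrow> y \<in> ?D \<Longrightarrow> x \<le> z \<Longrightarrow> z \<le> y \<Longrightarrow> z \<in> ?D" "0 \<notin> ?D"
    unfolding connected_iff_interval by blast+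
  show False
  proof -
    have "det M \<le> 0 \<and> 0 \<le> det N \<or> det N \<le> 0 \<and> 0 \<le> det M"
      using neg by (auto simp: zero_less_mult_iff)
    then show False
      using c(1)[OF MN, of 0] c(1)[OF MN(2,1), of 0] c(2) by metis
  qed
qed

lemma path_connected_det_pos: "path_connected {M :: real^'n^'n. 0 < det M}"
proof -
  have 1: "gl_connected M (mat 1)" if "0 < det M" for M :: "real^'n^'n"
  proof -
    have "\<not> gl_connected M (diag_refl k)" for k
      using gl_connected_sgn_det[of M "diag_refl k"] that by (auto simp: det_diag_refl)
    then show ?thesis using gl_connected_mat_1_or_diag_refl[of M] that by auto
  qed
  show ?thesis
    unfolding path_connected_component
  proof (intro ballI)
    fix M N :: "real^'n^'n" assume "M \<in> {M. 0 < det M}" "N \<in> {M. 0 < det M}"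
    then have "gl_connected M N"
      using 1 gl_connected_sym gl_connected_trans by blast
    then obtain g where g: "path g" "path_image g \<subseteq> {M. det M \<noteq> 0}" "pathstart g = M" "pathfinish g = N"
      unfolding gl_connected_def path_component_def by auto
    \<comment> \<open>The path is only known to avoid determinant 0; its initial pieces join
      \<open>M\<close> to each of its points, so the sign persists along it.\<close>
    have "0 < det X" if X: "X \<in> path_image g" for X
    proof -
      obtain t where t: "t \<in> {0..1}" "X = g t" using X by (auto simp: path_image_def)
      have "gl_connected M X"
        unfolding gl_connected_def path_component_def
      proof (intro exI[of _ "subpath 0 t g"] conjI)
        show "path_image (subpath 0 t g) \<subseteq> {M. det M \<noteq> 0}"
          using path_image_subpath_subset[of 0 t g] g(2) t(1) by auto
        show "path (subpath 0 t g)" using g(1) t(1) by (simp add: path_subpath)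
      qed (use g(3) t in \<open>simp_all add: pathstart_def pathfinish_def subpath_def\<close>)
      then have "0 < det M * det X" by (rule gl_connected_sgn_det)
      then show ?thesis using \<open>M \<in> _\<close> by (simp add: zero_less_mult_iff)
    qed
    then show "path_component {M. 0 < det M} M N"
      unfolding path_component_def using g by blast
  qed
qed

text \<open>A fixed reflection, being its own inverse, maps the matrices of positive determinant
  onto those of negative determinant.\<close>

lemma path_connected_det_neg: "path_connected {M :: real^'n^'n. det M < 0}"
proof -
  fix k :: 'n
  have "{M. det M < 0} = (\<lambda>M. diag_refl k ** M) ` {M. 0 < det M}"
  proof safe
    fix M :: "real^'n^'n" assume "det M < 0"
    then have "diag_refl k ** M \<in> {M. 0 < det M}"
      "M = diag_refl k ** (diag_refl k ** M)"
      by (auto simp: det_mul det_diag_refl matrix_mul_assoc diag_refl_involution)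
    then show "M \<in> (\<lambda>M. diag_refl k ** M) ` {M. 0 < det M}" by blast
  qed (simp add: det_mul det_diag_refl)
  moreover have "path_connected ((\<lambda>M. diag_refl k ** M) ` {M. 0 < det M})"
    by (intro path_connected_continuous_image path_connected_det_pos continuous_intros)
  ultimately show ?thesis by simp
qed

section \<open>Principal value of the resolvent\<close>

definition cvec :: "real^'n \<Rightarrow> complex^'n" where
  "cvec c = (\<chi> i. complex_of_real (c $ i))"

definition resolvent_vec :: "real^'n^'n \<Rightarrow> real^'n \<Rightarrow> complex \<Rightarrow> complex^'n" where
  "resolvent_vec G c s = matrix_inv (mat s - cmat G) *v cvec c"

text \<open>Stability in the form needed for contour integration: the resolvent exists on the closed
  right half plane, imaginary axis included.\<close>

definition no_unstable_eigenvalue :: "real^'n^'n \<Rightarrow> bool" where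
  "no_unstable_eigenvalue G \<longleftrightarrow> (\<forall>s. 0 \<le> Re s \<longrightarrow> det (mat s - cmat G) \<noteq> 0)"

lemma mat_vector_mult: "(mat s :: 'a::semiring_1^'n^'n) *v x = s *s x"
proof -
  have "(mat s *v x) $ i = s * x $ i" for i
  proof -
    have "(mat s *v x) $ i = (\<Sum>j\<in>UNIV. (mat s :: 'a^'n^'n) $ i $ j * x $ j)"
      by (simp add: matrix_vector_mult_def)
    also have "\<dots> = (\<Sum>j\<in>UNIV. if j = i then s * x $ i else 0)"
      by (rule sum.cong) (auto simp: mat_def)
    finally show ?thesis by simp
  qed
  then show ?thesis by (simp add: vec_eq_iff)
qed

lemma hurwitz_iff_no_unstable_eigenvalue: "hurwitz M \<longleftrightarrow> no_unstable_eigenvalue M"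
proof -
  have "det (mat s - cmat M) = 0 \<longleftrightarrow> (\<exists>v. v \<noteq> 0 \<and> cmat M *v v = s *s v)" for s
  proof -
    have "det (mat s - cmat M) = 0 \<longleftrightarrow> \<not> invertible (mat s - cmat M)"
      by (simp add: invertible_det_nz)
    also have "\<dots> \<longleftrightarrow> \<not> (\<forall>v. (mat s - cmat M) *v v = 0 \<longrightarrow> v = 0)"
      by (simp only: invertible_left_inverse matrix_left_invertible_ker)
    finally have "det (mat s - cmat M) = 0 \<longleftrightarrow> (\<exists>v. v \<noteq> 0 \<and> (mat s - cmat M) *v v = 0)"
      by auto
    then show ?thesis
      unfolding matrix_vector_mult_diff_rdistrib mat_vector_mult right_minus_eq by auto
  qed
  then show ?thesis
    unfolding hurwitz_def no_unstable_eigenvalue_def by (metis not_le)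
qed

lemma no_unstable_eigenvalue_transpose:
  assumes "no_unstable_eigenvalue M" shows "no_unstable_eigenvalue (transpose M)"
proof -
  have "mat s - cmat (transpose M) = transpose (mat s - cmat M)" for s
    by (auto simp: vec_eq_iff transpose_def cmat_def mat_def)
  then show ?thesis
    using assms by (simp add: no_unstable_eigenvalue_def)
qed

lemma resolvent_vec_eq:
  assumes "det (mat s - cmat G) \<noteq> 0"
  shows "(mat s - cmat G) *v resolvent_vec G c s = cvec c"
  unfolding resolvent_vec_def matrix_vector_mul_assoc matrix_inv_right[OF assms] by simp

lemma norm_vector_smult: "norm (s *s x) = cmod s * norm (x :: complex^'n)"
  by (simp add: norm_vec_def norm_mult L2_set_right_distrib)

lemma matrix_vector_mult_bound:
  fixes M :: "complex^'n^'m"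
  obtains B where "B > 0" "\<And>x. norm (M *v x) \<le> B * norm x"
proof -
  have "linear ((*v) M)"
    by (rule linearI)
       (simp_all add: vec_eq_iff matrix_vector_mult_def sum.distrib algebra_simps scaleR_right.sum)
  then show ?thesis using linear_bounded_pos that by blast
qed

text \<open>The leading term is taken as c/(s+1) rather than c/s to avoid a pole in the closed right
  half plane. The remainder \<open>g\<close> solves s g = G g + d/(s+1); once the modulus of s is at
  least 2 B, the term G g is absorbed by half of the left side.\<close>

lemma resolvent_vec_decay:
  assumes G: "no_unstable_eigenvalue G"
  obtains C r where "C \<ge> 0" "r > 0"
    "\<And>s k. 0 \<le> Re s \<Longrightarrow> r \<le> cmod s \<Longrightarrow>
      cmod (resolvent_vec G c s $ k - complex_of_real (c $ k) / (s + 1)) \<le> C / (cmod s)\<^sup>2"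
proof -
  obtain B where B: "B > 0" "\<And>x. norm (cmat G *v x) \<le> B * norm x"
    using matrix_vector_mult_bound by blast
  define d where "d = cvec c + cmat G *v cvec c"
  show ?thesis
  proof (rule that[of "2 * norm d" "2 * B"])
    fix s :: complex and k assume s: "0 \<le> Re s" "2 * B \<le> cmod s"
    define g where "g = resolvent_vec G c s - inverse (s + 1) *s cvec c"
    have s1: "s + 1 \<noteq> 0" using s(1) by (auto simp: complex_eq_iff)
    have "(mat s - cmat G) *v g = cvec c - (mat s - cmat G) *v (inverse (s + 1) *s cvec c)"
      unfolding g_def matrix_vector_mult_diff_distrib
      using resolvent_vec_eq[of s G c] G s(1) unfolding no_unstable_eigenvalue_def by metis
    also have "\<dots> = inverse (s + 1) *s ((s + 1) *s cvec c - (mat s - cmat G) *v cvec c)"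
    proof -
      have "cvec c = inverse (s + 1) *s ((s + 1) *s cvec c)"
        by (simp only: vector_smult_assoc left_inverse[OF s1] vector_smult_lid)
      then show ?thesis by (simp only: vector_ssub_ldistrib vector_scalar_commute[symmetric])
    qed
    also have "(s + 1) *s cvec c - (mat s - cmat G) *v cvec c = d"
      by (simp add: d_def matrix_vector_mult_diff_rdistrib mat_vector_mult vec_eq_iff algebra_simps)
    finally have g: "s *s g = cmat G *v g + inverse (s + 1) *s d"
      by (simp add: matrix_vector_mult_diff_rdistrib mat_vector_mult algebra_simps)
    have "(cmod s)\<^sup>2 \<le> (cmod (s + 1))\<^sup>2"
      using s(1) unfolding cmod_power2 by (simp add: power2_eq_square algebra_simps)
    then have s2: "cmod s \<le> cmod (s + 1)" by (rule power2_le_imp_le) simp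
    have sp: "cmod s > 0" using s(2) B(1) by linarith
    have "cmod s * norm g = norm (cmat G *v g + inverse (s + 1) *s d)"
      by (metis g norm_vector_smult)
    also have "\<dots> \<le> B * norm g + norm d / cmod (s + 1)"
      using norm_triangle_ineq[of "cmat G *v g" "inverse (s + 1) *s d"] B(2)[of g]
      by (simp add: norm_vector_smult norm_inverse divide_inverse mult.commute)
    also have "\<dots> \<le> B * norm g + norm d / cmod s"
      using s2 sp by (intro add_left_mono divide_left_mono mult_pos_pos) auto
    also have "B * norm g \<le> cmod s / 2 * norm g"
      using s(2) by (intro mult_right_mono) auto
    finally have "cmod s / 2 * norm g \<le> norm d / cmod s" by (simp add: field_simps)
    then have "norm g \<le> 2 * norm d / (cmod s)\<^sup>2"
      using sp by (simp add: field_simps power2_eq_square)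
    moreover have "cmod (g $ k) \<le> norm g" by (rule Finite_Cartesian_Product.norm_nth_le)
    moreover have "g $ k = resolvent_vec G c s $ k - complex_of_real (c $ k) / (s + 1)"
      by (simp add: g_def cvec_def divide_inverse mult.commute)
    ultimately show "cmod (resolvent_vec G c s $ k - complex_of_real (c $ k) / (s + 1)) \<le> 2 * norm d / (cmod s)\<^sup>2"
      by simp
  qed (use B in auto)
qed

lemma open_det_resolvent_nz: "open {s. det (mat s - cmat G) \<noteq> 0}"
proof -
  have "continuous_on UNIV (\<lambda>s. mat s - cmat G)"
  proof (rule continuous_on_matrixI)
    fix i j
    show "continuous_on UNIV (\<lambda>s. (mat s - cmat G) $ i $ j)"
      by (cases "i = j") (auto simp: mat_def intro!: continuous_intros)
  qed
  then show ?thesis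
    by (intro open_Collect_neq continuous_on_det continuous_on_const)
qed

text \<open>By Cramer's rule each component is a quotient of polynomials in
  \<open>s\<close>.\<close>

lemma resolvent_vec_holomorphic:
  "(\<lambda>s. resolvent_vec G c s $ k) holomorphic_on {s. det (mat s - cmat G) \<noteq> 0}"
proof -
  let ?D = "\<lambda>s. \<chi> i j. if j = k then cvec c $ i else (mat s - cmat G) $ i $ j"
  have m: "(\<lambda>s. (mat s - cmat G) $ i $ j) holomorphic_on S" for i j S
    by (cases "i = j") (auto simp: mat_def intro!: holomorphic_intros)
  have m': "(\<lambda>s. ?D s $ i $ j) holomorphic_on S" for i j S
    using m by (cases "j = k") (auto intro!: holomorphic_intros)
  have "(\<lambda>s. det (?D s) / det (mat s - cmat G)) holomorphic_on {s. det (mat s - cmat G) \<noteq> 0}"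
    unfolding det_def[of "?D _"] unfolding det_def[of "mat _ - cmat G"]
    by (intro holomorphic_intros m m') (auto simp: det_def)
  then show ?thesis
  proof (rule holomorphic_transform)
    fix s assume "s \<in> {s. det (mat s - cmat G) \<noteq> 0}"
    then have nz: "det (mat s - cmat G) \<noteq> 0" by simp
    show "det (?D s) / det (mat s - cmat G) = resolvent_vec G c s $ k"
      using resolvent_vec_eq[OF nz, of c] unfolding cramer_component[OF nz] by simp
  qed
qed

lemma has_integral_Re:
  assumes "(f has_integral y) S" shows "((\<lambda>x. Re (f x)) has_integral Re y) S"
  using has_integral_linear[OF assms bounded_linear_Re] by (simp add: o_def)

text \<open>Only the part decaying like \<^term>\<open>1 / s\<^sup>2\<close> needs Cauchy's theorem: its integral over the
  segment equals that over a half circle in the right half plane, which tends to 0.\<close>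

lemma resolvent_vec_principal_value_component:
  assumes G: "no_unstable_eigenvalue G"
  obtains I where "\<And>N. 0 < N \<Longrightarrow>
      ((\<lambda>\<omega>. Re (resolvent_vec G c (\<i> * of_real \<omega>) $ k)) has_integral I N) {- N..N}"
    "(I \<longlongrightarrow> pi * c $ k) at_top"
proof -
  define f where "f s = resolvent_vec G c s $ k - complex_of_real (c $ k) / (s + 1)" for s
  define H where "H = {s. 0 \<le> Re s}"
  define U where "U = {s. det (mat s - cmat G) \<noteq> 0} \<inter> - {- 1}"
  have HU: "H \<subseteq> U" using G by (auto simp: H_def U_def no_unstable_eigenvalue_def)
  have "open U" unfolding U_def by (intro open_Int open_det_resolvent_nz) auto
  have holo: "f holomorphic_on U"
    unfolding f_def U_def
    by (intro holomorphic_intros holomorphic_on_subset[OF resolvent_vec_holomorphic])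
       (auto simp: add_eq_0_iff2)
  have "convex H" unfolding H_def by (rule convex_halfspace_Re_ge)
  \<comment> \<open>The half plane is convex, so a primitive exists; segment and half circle share
    their end points and therefore the contour integral \<open>E N\<close>.\<close>
  obtain F where F: "\<And>s. s \<in> H \<Longrightarrow> (F has_field_derivative f s) (at s within H)"
  proof (rule holomorphic_convex_primitive[of H "{}" f])
    show "continuous_on H f"
      using holo HU holomorphic_on_imp_continuous_on holomorphic_on_subset by blast
    show "f field_differentiable at x" if "x \<in> interior H - {}" for x
      using holo \<open>open U\<close> HU that interior_subset[of H]
      by (auto intro: holomorphic_on_imp_differentiable_at)
  qed (use \<open>convex H\<close> in auto)
  define E where "E N = F (\<i> * of_real N) - F (- \<i> * of_real N)" for N
  obtain C r where C: "C \<ge> 0" "r > 0"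
    "\<And>s k. 0 \<le> Re s \<Longrightarrow> r \<le> cmod s \<Longrightarrow>
      cmod (resolvent_vec G c s $ k - complex_of_real (c $ k) / (s + 1)) \<le> C / (cmod s)\<^sup>2"
    using resolvent_vec_decay[OF G] by blast
  \<comment> \<open>Arc length pi N times the bound C / N^2.\<close>
  have Ebound: "cmod (E N) \<le> C * pi / N" if N: "r \<le> N" for N
  proof -
    let ?\<gamma> = "part_circlepath 0 N (- (pi / 2)) (pi / 2)"
    have N0: "N > 0" using N C(2) by linarith
    have pi_half_le: "- (pi / 2) \<le> pi / 2" by simp
    have img: "Re x \<ge> 0 \<and> cmod x = N" if x: "x \<in> path_image ?\<gamma>" for x
    proof -
      obtain t where t: "- (pi / 2) \<le> t" "t \<le> pi / 2" "x = of_real N * exp (\<i> * of_real t)"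
        using x unfolding path_image_part_circlepath[of "- (pi / 2)" "pi / 2" 0 N, OF pi_half_le] by auto
      show ?thesis using t N0 by (auto simp: Re_exp norm_mult intro!: mult_nonneg_nonneg cos_ge_zero)
    qed
    have "(f has_contour_integral (F (pathfinish ?\<gamma>) - F (pathstart ?\<gamma>))) ?\<gamma>"
      by (rule contour_integral_primitive[of H]) (use F img in \<open>auto simp: H_def\<close>)
    moreover have "pathfinish ?\<gamma> = \<i> * of_real N" "pathstart ?\<gamma> = - \<i> * of_real N"
      by (simp_all add: exp_eq_polar cis.ctr complex_eq_iff Re_exp Im_exp)
    ultimately have "(f has_contour_integral E N) ?\<gamma>" unfolding E_def by metis
    moreover have "cmod (f x) \<le> C / N\<^sup>2" if "x \<in> path_image ?\<gamma>" for x
      using img[OF that] C(3)[of x k] N by (simp add: f_def)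
    ultimately have "cmod (E N) \<le> C / N\<^sup>2 * N * (pi / 2 - - (pi / 2))"
      by (intro has_contour_integral_bound_part_circlepath) (use C N0 in auto)
    then show ?thesis using N0 by (simp add: power2_eq_square field_simps)
  qed
  have E0: "(E \<longlongrightarrow> 0) at_top"
  proof (rule Lim_null_comparison)
    show "\<forall>\<^sub>F N in at_top. norm (E N) \<le> C * pi / N"
      using Ebound eventually_ge_at_top by (rule eventually_mono[rotated])
    show "((\<lambda>N. C * pi / N) \<longlongrightarrow> 0) at_top"
      by (intro tendsto_divide_0[OF tendsto_const] filterlim_at_top_imp_at_infinity filterlim_ident)
  qed
  have int_f: "((\<lambda>\<omega>. f (\<i> * of_real \<omega>)) has_integral - \<i> * E N) {- N..N}" if "0 < N" for N
  proof -
    have "((\<lambda>\<omega>. \<i> * f (\<i> * of_real \<omega>)) has_integral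
        (F \<circ> (\<lambda>\<omega>. \<i> * of_real \<omega>)) N - (F \<circ> (\<lambda>\<omega>. \<i> * of_real \<omega>)) (- N)) {- N..N}"
    proof (rule fundamental_theorem_of_calculus)
      fix \<omega> assume "\<omega> \<in> {- N..N}"
      have "((\<lambda>\<omega>. \<i> * of_real \<omega>) has_vector_derivative \<i> * 1) (at \<omega> within {- N..N})"
        using bounded_linear.has_vector_derivative[OF bounded_linear_of_real has_vector_derivative_id]
        by (intro has_vector_derivative_mult_right) (simp add: id_def)
      moreover have "(F has_field_derivative f (\<i> * of_real \<omega>))
          (at (\<i> * of_real \<omega>) within (\<lambda>\<omega>. \<i> * of_real \<omega>) ` {- N..N})"
        by (rule DERIV_subset[OF F]) (auto simp: H_def)
      ultimately show "((F \<circ> (\<lambda>\<omega>. \<i> * of_real \<omega>)) has_vector_derivative \<i> * f (\<i> * of_real \<omega>))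
          (at \<omega> within {- N..N})"
        using field_vector_diff_chain_within by fastforce
    qed (use that in auto)
    from has_integral_mult_right[OF this, of "- \<i>"] show ?thesis by (simp add: E_def mult.assoc[symmetric])
  qed
  show ?thesis
  proof (rule that[of "\<lambda>N. Re (- \<i> * E N) + c $ k * (arctan N - arctan (- N))"])
    fix N :: real assume N: "0 < N"
    \<comment> \<open>On the imaginary axis the subtracted term has real part c_k / (1 +
      \<omega>^2); its integral, an arctan, supplies the whole limit pi c_k.\<close>
    have "((\<lambda>\<omega>. inverse (1 + \<omega>\<^sup>2)) has_integral arctan N - arctan (- N)) {- N..N}"
      by (rule fundamental_theorem_of_calculus)
         (use N in \<open>auto simp flip: has_real_derivative_iff_has_vector_derivative intro!: DERIV_subset[OF DERIV_arctan]\<close>)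
    from has_integral_add[OF has_integral_Re[OF int_f[OF N]] has_integral_mult_right[OF this, of "c $ k"]]
    have *: "((\<lambda>\<omega>. Re (f (\<i> * of_real \<omega>)) + c $ k * inverse (1 + \<omega>\<^sup>2)) has_integral
        Re (- \<i> * E N) + c $ k * (arctan N - arctan (- N))) {- N..N}" .
    have "Re (f (\<i> * of_real \<omega>)) + c $ k * inverse (1 + \<omega>\<^sup>2) = Re (resolvent_vec G c (\<i> * of_real \<omega>) $ k)" for \<omega>
      by (simp add: f_def Re_divide cmod_power2[symmetric] divide_inverse)
    with * show "((\<lambda>\<omega>. Re (resolvent_vec G c (\<i> * of_real \<omega>) $ k)) has_integral
        Re (- \<i> * E N) + c $ k * (arctan N - arctan (- N))) {- N..N}" by simp
  next
    have "((\<lambda>N. Re (- \<i> * E N) + c $ k * (arctan N - arctan (- N))) \<longlongrightarrow>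
        Re (- \<i> * 0) + c $ k * (pi / 2 - - (pi / 2))) at_top"
      unfolding arctan_minus by (intro tendsto_intros E0 tendsto_arctan_at_top)
    then show "((\<lambda>N. Re (- \<i> * E N) + c $ k * (arctan N - arctan (- N))) \<longlongrightarrow> pi * c $ k) at_top"
      by (simp add: mult.commute)
  qed
qed

section \<open>Real form of the resolvent equation\<close>

definition re_resolvent :: "real^'n^'n \<Rightarrow> real^'n \<Rightarrow> real \<Rightarrow> real^'n" where
  "re_resolvent G c \<omega> = (\<chi> k. Re (resolvent_vec G c (\<i> * of_real \<omega>) $ k))"

text \<open>The minus sign writes the resolvent vector as p - i q, with p the
  \<open>re_resolvent\<close>.\<close>

definition im_resolvent :: "real^'n^'n \<Rightarrow> real^'n \<Rightarrow> real \<Rightarrow> real^'n" where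
  "im_resolvent G c \<omega> = (\<chi> k. - Im (resolvent_vec G c (\<i> * of_real \<omega>) $ k))"

lemma re_resolvent_principal_value:
  fixes G :: "real^'n^'n"
  assumes G: "no_unstable_eigenvalue G"
  obtains I where "\<And>N. 0 < N \<Longrightarrow> (re_resolvent G c has_integral I N) {- N..N}"
    "(I \<longlongrightarrow> pi *\<^sub>R c) at_top"
proof -
  have "\<forall>k. \<exists>I. (\<forall>N>0. ((\<lambda>\<omega>. Re (resolvent_vec G c (\<i> * of_real \<omega>) $ k)) has_integral I N) {- N..N})
    \<and> (I \<longlongrightarrow> pi * c $ k) at_top"
    using resolvent_vec_principal_value_component[OF G] by metis
  then obtain I where I: "\<And>k N. N > 0 \<Longrightarrow>
      ((\<lambda>\<omega>. Re (resolvent_vec G c (\<i> * of_real \<omega>) $ k)) has_integral I k N) {- N..N}"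
      "\<And>k. (I k \<longlongrightarrow> pi * c $ k) at_top"
    by metis
  have basis: "x = (\<Sum>k\<in>UNIV. (x $ k) *\<^sub>R axis k 1)" for x :: "real^'n"
    using basis_expansion[of x] by (simp add: scalar_mult_eq_scaleR)
  show ?thesis
  proof (rule that[of "\<lambda>N. \<Sum>k\<in>UNIV. I k N *\<^sub>R axis k 1"])
    fix N :: real assume "0 < N"
    then have "((\<lambda>\<omega>. \<Sum>k\<in>UNIV. re_resolvent G c \<omega> $ k *\<^sub>R axis k 1) has_integral
        (\<Sum>k\<in>UNIV. I k N *\<^sub>R axis k 1)) {- N..N}"
      using I(1) by (intro has_integral_sum has_integral_scaleR_left) (auto simp: re_resolvent_def)
    then show "(re_resolvent G c has_integral (\<Sum>k\<in>UNIV. I k N *\<^sub>R axis k 1)) {- N..N}"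
      by (subst (asm) basis[symmetric])
  next
    have "((\<lambda>N. \<Sum>k\<in>UNIV. I k N *\<^sub>R axis k 1) \<longlongrightarrow> (\<Sum>k\<in>UNIV. (pi * c $ k) *\<^sub>R (axis k 1 :: real^'n))) at_top"
      by (intro tendsto_sum tendsto_scaleR I(2) tendsto_const)
    also have "(\<Sum>k\<in>UNIV. (pi * c $ k) *\<^sub>R axis k 1) = pi *\<^sub>R c"
      by (subst basis[of "pi *\<^sub>R c"]) simp
    finally show "((\<lambda>N. \<Sum>k\<in>UNIV. I k N *\<^sub>R axis k 1) \<longlongrightarrow> pi *\<^sub>R c) at_top" .
  qed
qed

lemma resolvent_equations:
  assumes G: "no_unstable_eigenvalue G"
  shows "G *v re_resolvent G c \<omega> = \<omega> *\<^sub>R im_resolvent G c \<omega> - c"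
    and "G *v im_resolvent G c \<omega> = - \<omega> *\<^sub>R re_resolvent G c \<omega>"
proof -
  let ?u = "resolvent_vec G c (\<i> * of_real \<omega>)"
  have "(mat (\<i> * of_real \<omega>) - cmat G) *v ?u = cvec c"
    using G by (intro resolvent_vec_eq) (simp add: no_unstable_eigenvalue_def)
  then have *: "\<i> * of_real \<omega> * ?u $ k - (\<Sum>j\<in>UNIV. of_real (G $ k $ j) * ?u $ j) = of_real (c $ k)" for k
    unfolding matrix_vector_mult_diff_rdistrib mat_vector_mult vec_eq_iff
    by (auto simp: matrix_vector_mult_def cmat_def cvec_def dest: spec[of _ k])
  show "G *v re_resolvent G c \<omega> = \<omega> *\<^sub>R im_resolvent G c \<omega> - c"
    using arg_cong[OF *, of Re]
    by (simp add: vec_eq_iff re_resolvent_def im_resolvent_def matrix_vector_mult_def)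
       (smt (verit))
  show "G *v im_resolvent G c \<omega> = - \<omega> *\<^sub>R re_resolvent G c \<omega>"
    using arg_cong[OF *, of Im]
    by (simp add: vec_eq_iff re_resolvent_def im_resolvent_def matrix_vector_mult_def sum_negf)
qed

lemma continuous_on_resolvent:
  assumes G: "no_unstable_eigenvalue G"
  shows "continuous_on UNIV (re_resolvent G c)" "continuous_on UNIV (im_resolvent G c)"
proof -
  have "continuous_on UNIV (\<lambda>\<omega>. resolvent_vec G c (\<i> * of_real \<omega>) $ k)" for k
    by (rule continuous_on_compose2[OF holomorphic_on_imp_continuous_on[OF resolvent_vec_holomorphic]])
       (use G in \<open>auto simp: no_unstable_eigenvalue_def intro!: continuous_intros\<close>)
  then show "continuous_on UNIV (re_resolvent G c)" "continuous_on UNIV (im_resolvent G c)"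
    unfolding re_resolvent_def im_resolvent_def
    by (intro continuous_on_vec_lambda continuous_on_Re continuous_on_Im continuous_on_minus; assumption)+
qed

section \<open>Lyapunov certificates for the H2 norm\<close>

text \<open>After substituting \<open>resolvent_equations\<close>, the terms carrying \<omega>
  cancel between real and imaginary parts. What remains is linear in the real part alone, exactly
  the part whose principal value is known.\<close>

lemma resolvent_lyapunov_identity:
  assumes G: "no_unstable_eigenvalue G"
  shows "(G *v re_resolvent G c \<omega>) \<bullet> (P *v re_resolvent G d \<omega>)
       + re_resolvent G c \<omega> \<bullet> (P *v (G *v re_resolvent G d \<omega>))
       + (G *v im_resolvent G c \<omega>) \<bullet> (P *v im_resolvent G d \<omega>)
       + im_resolvent G c \<omega> \<bullet> (P *v (G *v im_resolvent G d \<omega>))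
       = - (c \<bullet> (P *v re_resolvent G d \<omega>) + re_resolvent G c \<omega> \<bullet> (P *v d))"
  unfolding resolvent_equations[OF G]
  by (simp add: matrix_vector_mult_diff_distrib matrix_vector_mult_scaleR inner_diff_left inner_diff_right
      algebra_simps linear_neg[OF matrix_vector_mul_linear])

lemma transpose_add: "transpose (M + N) = transpose M + transpose N"
  by (simp add: vec_eq_iff transpose_def)

lemma transpose_uminus: "transpose (- M) = - transpose M"
  by (simp add: vec_eq_iff transpose_def)

lemma matrix_vector_mult_minus_left: "(- M) *v x = - (M *v (x :: 'a::ring_1^'n))"
  by (simp add: vec_eq_iff matrix_vector_mult_def sum_negf)

lemma matrix_add_rdistrib: "(M + N) ** K = M ** K + N ** K"
  by (simp add: vec_eq_iff matrix_matrix_mult_def distrib_right sum.distrib)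

lemma matrix_mult_scaleR_left: "(c *\<^sub>R M) ** N = c *\<^sub>R (M ** (N :: real^'k^'n))"
  by (simp add: vec_eq_iff matrix_matrix_mult_def sum_distrib_left mult.assoc)

lemma matrix_mult_scaleR_right: "M ** (c *\<^sub>R N) = c *\<^sub>R (M ** (N :: real^'k^'n))"
  by (simp add: vec_eq_iff matrix_matrix_mult_def sum_distrib_left mult.left_commute)

lemma inner_matrix_vector_right: "x \<bullet> (M *v y) = (transpose M *v x) \<bullet> (y :: real^'n)"
  by (metis dot_lmul_matrix vector_transpose_matrix transpose_transpose)

lemma matrix_eq_0_if_inner:
  fixes M :: "real^'n^'m"
  assumes "\<And>c d. c \<bullet> (M *v d) = 0" shows "M = 0"
proof -
  have "M *v d = 0" for d using assms[of "M *v d" d] by simp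
  then show ?thesis by (simp add: matrix_eq)
qed

text \<open>For \<open>P\<close> in the kernel the left side of
  \<open>resolvent_lyapunov_identity\<close> vanishes at every frequency; integrating the right side
  over symmetric intervals gives 2 pi (c \<bullet> P d) = 0 in the limit.\<close>

lemma lyapunov_kernel:
  assumes A: "no_unstable_eigenvalue A" and 0: "A ** P + P ** transpose A = 0"
  shows "P = 0"
proof (rule matrix_eq_0_if_inner)
  fix c d
  let ?G = "transpose A"
  have G: "no_unstable_eigenvalue ?G" using A by (rule no_unstable_eigenvalue_transpose)
  obtain I where I: "\<And>N. 0 < N \<Longrightarrow> (re_resolvent ?G c has_integral I N) {- N..N}"
    "(I \<longlongrightarrow> pi *\<^sub>R c) at_top" using re_resolvent_principal_value[OF G] by metis
  obtain J where J: "\<And>N. 0 < N \<Longrightarrow> (re_resolvent ?G d has_integral J N) {- N..N}"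
    "(J \<longlongrightarrow> pi *\<^sub>R d) at_top" using re_resolvent_principal_value[OF G] by metis
  have sym: "(?G *v x) \<bullet> (P *v y) + x \<bullet> (P *v (?G *v y)) = 0" for x y
  proof -
    have "(?G *v x) \<bullet> (P *v y) + x \<bullet> (P *v (?G *v y)) = x \<bullet> ((A ** P + P ** ?G) *v y)"
      by (simp add: matrix_vector_mult_add_rdistrib inner_add_right inner_matrix_vector_right[of x A]
          flip: matrix_vector_mul_assoc)
    then show ?thesis using 0 by simp
  qed
  have z: "c \<bullet> (P *v re_resolvent ?G d \<omega>) + re_resolvent ?G c \<omega> \<bullet> (P *v d) = 0" for \<omega>
    using resolvent_lyapunov_identity[OF G, of c \<omega> P d]
      sym[of "re_resolvent ?G c \<omega>" "re_resolvent ?G d \<omega>"]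
      sym[of "im_resolvent ?G c \<omega>" "im_resolvent ?G d \<omega>"] by linarith
  have "c \<bullet> (P *v J N) + I N \<bullet> (P *v d) = 0" if N: "0 < N" for N
  proof -
    have "bounded_linear (\<lambda>x. c \<bullet> (P *v x))" "bounded_linear (\<lambda>x. x \<bullet> (P *v d))"
      by (auto intro!: bounded_linear_intros bounded_linear_compose[OF bounded_linear_inner_right])
    from has_integral_add[OF has_integral_linear[OF J(1)[OF N] this(1)]
        has_integral_linear[OF I(1)[OF N] this(2)]]
    have "((\<lambda>\<omega>. 0) has_integral c \<bullet> (P *v J N) + I N \<bullet> (P *v d)) {- N..N}"
      by (simp add: o_def z)
    then show ?thesis using has_integral_unique has_integral_0 by blast
  qed
  then have ev: "\<forall>\<^sub>F N in at_top. c \<bullet> (P *v J N) + I N \<bullet> (P *v d) = 0"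
    by (intro eventually_mono[OF eventually_gt_at_top[of "0::real"]])
  have "((\<lambda>N. c \<bullet> (P *v J N) + I N \<bullet> (P *v d)) \<longlongrightarrow> c \<bullet> (P *v (pi *\<^sub>R d)) + (pi *\<^sub>R c) \<bullet> (P *v d)) at_top"
    by (intro tendsto_intros I(2) bounded_linear.tendsto[OF matrix_vector_mul_bounded_linear J(2)])
  moreover have "((\<lambda>N. c \<bullet> (P *v J N) + I N \<bullet> (P *v d)) \<longlongrightarrow> 0) at_top"
    using ev by (rule tendsto_eventually)
  ultimately have "c \<bullet> (P *v (pi *\<^sub>R d)) + (pi *\<^sub>R c) \<bullet> (P *v d) = 0"
    using tendsto_unique trivial_limit_at_top_linorder by blast
  then show "c \<bullet> (P *v d) = 0" by (simp add: matrix_vector_mult_scaleR)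
qed

text \<open>An injective linear map of the finite-dimensional matrix space is onto, and the
  transpose of a solution solves the same equation, so uniqueness forces symmetry.\<close>

lemma lyapunov_solution:
  fixes A M :: "real^'n^'n"
  assumes A: "no_unstable_eigenvalue A" and M: "transpose M = M"
  obtains P where "transpose P = P" "A ** P + P ** transpose A = M"
proof -
  let ?L = "\<lambda>P. A ** P + P ** transpose A"
  have lin: "linear ?L"
    by (rule linearI)
       (simp_all add: matrix_add_ldistrib matrix_add_rdistrib scaleR_right_distrib
          matrix_mult_scaleR_left matrix_mult_scaleR_right)
  have inj: "inj ?L"
    unfolding linear_injective_0[OF lin] using lyapunov_kernel[OF A] by blast
  obtain P where P: "M = ?L P"
    using linear_injective_imp_surjective[OF lin inj] unfolding surj_def by blast
  have "?L (transpose P) = transpose (?L P)"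
    by (simp add: transpose_add matrix_transpose_mul add.commute)
  then have "?L (transpose P) = ?L P" using P M by simp
  then have "transpose P = P" by (rule injD[OF inj])
  then show ?thesis using P that by blast
qed

text \<open>For symmetric \<open>P\<close>, \<open>\<phi>\<close> is the quadratic form of -(A P + P
  A^T). The identity turns the integrand into 2 (c \<bullet> P p), p the real part of the resolvent,
  and p has principal value pi c.\<close>

lemma resolvent_lyapunov_integral:
  assumes A: "no_unstable_eigenvalue A" and P: "transpose P = P"
  defines "\<phi> \<equiv> \<lambda>x. - 2 * (x \<bullet> (A *v (P *v x)))"
  obtains J where "\<And>N. 0 < N \<Longrightarrow>
      ((\<lambda>\<omega>. \<phi> (re_resolvent (transpose A) c \<omega>) + \<phi> (im_resolvent (transpose A) c \<omega>)) has_integral J N) {- N..N}"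
    "(J \<longlongrightarrow> 2 * pi * (c \<bullet> (P *v c))) at_top"
proof -
  let ?G = "transpose A"
  have G: "no_unstable_eigenvalue ?G" using A by (rule no_unstable_eigenvalue_transpose)
  obtain I where I: "\<And>N. 0 < N \<Longrightarrow> (re_resolvent ?G c has_integral I N) {- N..N}"
    "(I \<longlongrightarrow> pi *\<^sub>R c) at_top" using re_resolvent_principal_value[OF G] by metis
  have P': "x \<bullet> (P *v y) = (P *v x) \<bullet> y" for x y
    using P by (simp add: inner_matrix_vector_right)
  have \<phi>: "\<phi> x = - ((?G *v x) \<bullet> (P *v x) + x \<bullet> (P *v (?G *v x)))" for x
    unfolding \<phi>_def P'[of x "?G *v x"] inner_matrix_vector_right[of x A] by (simp add: inner_commute)
  have *: "\<phi> (re_resolvent ?G c \<omega>) + \<phi> (im_resolvent ?G c \<omega>) = 2 * (c \<bullet> (P *v re_resolvent ?G c \<omega>))" for \<omega>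
    using resolvent_lyapunov_identity[OF G, of c \<omega> P c] P'[of c "re_resolvent ?G c \<omega>"]
    by (simp add: \<phi> inner_commute)
  show ?thesis
  proof (rule that[of "\<lambda>N. 2 * (c \<bullet> (P *v I N))"])
    fix N :: real assume N: "0 < N"
    have "bounded_linear (\<lambda>x. 2 * (c \<bullet> (P *v x)))"
      by (intro bounded_linear_const_mult bounded_linear_compose[OF bounded_linear_inner_right]
          matrix_vector_mul_bounded_linear)
    from has_integral_linear[OF I(1)[OF N] this]
    show "((\<lambda>\<omega>. \<phi> (re_resolvent ?G c \<omega>) + \<phi> (im_resolvent ?G c \<omega>)) has_integral 2 * (c \<bullet> (P *v I N))) {- N..N}"
      by (simp add: o_def *)
  next
    have "((\<lambda>N. 2 * (c \<bullet> (P *v I N))) \<longlongrightarrow> 2 * (c \<bullet> (P *v (pi *\<^sub>R c)))) at_top"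
      by (intro tendsto_intros bounded_linear.tendsto[OF matrix_vector_mul_bounded_linear I(2)])
    then show "((\<lambda>N. 2 * (c \<bullet> (P *v I N))) \<longlongrightarrow> 2 * pi * (c \<bullet> (P *v c))) at_top"
      by (simp add: matrix_vector_mult_scaleR mult.assoc)
  qed
qed

text \<open>For a nonnegative integrand a principal value is a genuine integral, by monotone
  convergence.\<close>

lemma nn_integral_eq_limit_of_symmetric_integrals:
  fixes h :: "real \<Rightarrow> real"
  assumes h: "continuous_on UNIV h" "\<And>x. 0 \<le> h x"
    and J: "\<And>N. 0 < N \<Longrightarrow> (h has_integral J N) {- N..N}" "(J \<longlongrightarrow> L) at_top"
  shows "(\<integral>\<^sup>+ x. ennreal (h x) \<partial>lborel) = ennreal L"
proof (rule LIMSEQ_unique)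
  have [measurable]: "h \<in> borel_measurable borel" using h(1) by (rule borel_measurable_continuous_onI)
  \<comment> \<open>\<open>Suc n\<close> keeps the radius positive, where \<open>J\<close> is
    specified.\<close>
  let ?f = "\<lambda>n x. ennreal (h x) * indicator {- real (Suc n)..real (Suc n)} x"
  show "(\<lambda>n. \<integral>\<^sup>+ x. ?f n x \<partial>lborel) \<longlonglongrightarrow> (\<integral>\<^sup>+ x. ennreal (h x) \<partial>lborel)"
  proof (rule nn_integral_LIMSEQ)
    show "incseq ?f"
      by (auto simp: incseq_def le_fun_def intro!: mult_left_mono split: split_indicator)
    show "(\<lambda>n. ?f n x) \<longlonglongrightarrow> ennreal (h x)" for x
    proof (rule tendsto_eventually)
      obtain m where m: "\<bar>x\<bar> \<le> real m" using real_arch_simple by blast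
      show "\<forall>\<^sub>F n in sequentially. ?f n x = ennreal (h x)"
        using eventually_ge_at_top[of m] by eventually_elim (use m in \<open>auto simp: indicator_def\<close>)
    qed
  qed auto
  have "(\<integral>\<^sup>+ x. ?f n x \<partial>lborel) = ennreal (J (real (Suc n)))" for n
    by (rule nn_integral_has_integral_lebesgue'[OF h(2) J(1)]) simp
  moreover have "(\<lambda>n. J (real (Suc n))) \<longlonglongrightarrow> L"
    by (rule filterlim_compose[OF J(2)])
       (rule filterlim_compose[OF filterlim_real_sequentially filterlim_Suc])
  ultimately show "(\<lambda>n. \<integral>\<^sup>+ x. ?f n x \<partial>lborel) \<longlonglongrightarrow> ennreal L"
    by (simp add: tendsto_ennrealI)
qed

text \<open>Row \<open>i\<close> of the transfer matrix is u^T B, where u is the resolvent vector of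
  the transposed matrix at \<open>C $ i\<close>; this is why \<open>transpose A\<close> appears
  throughout.\<close>

lemma cmod_tf_jw_row:
  fixes A :: "real^'n^'n" and B :: "real^'w^'n" and C :: "real^'n^'z"
  assumes A: "no_unstable_eigenvalue A"
  shows "(\<Sum>j\<in>UNIV. (cmod (tf_jw A B C 0 \<omega> $ i $ j))\<^sup>2) =
    (norm (re_resolvent (transpose A) (C $ i) \<omega> v* B))\<^sup>2 + (norm (im_resolvent (transpose A) (C $ i) \<omega> v* B))\<^sup>2"
proof -
  let ?M = "mat (\<i> * of_real \<omega>) - cmat A"
  let ?u = "resolvent_vec (transpose A) (C $ i) (\<i> * of_real \<omega>)"
  have tr: "mat (\<i> * of_real \<omega>) - cmat (transpose A) = transpose ?M"
    by (auto simp: vec_eq_iff transpose_def cmat_def mat_def)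
  have nz: "det ?M \<noteq> 0" using A by (simp add: no_unstable_eigenvalue_def)
  have "transpose ?M ** transpose (matrix_inv ?M) = mat 1"
    by (simp add: matrix_inv_left[OF nz] flip: matrix_transpose_mul)
  then have "matrix_inv (transpose ?M) = transpose (matrix_inv ?M)"
    by (rule matrix_inv_unique_right)
  then have u: "?u = transpose (matrix_inv ?M) *v cvec (C $ i)"
    by (simp add: resolvent_vec_def tr)
  have "tf_jw A B C 0 \<omega> $ i $ j = (\<Sum>k\<in>UNIV. ?u $ k * of_real (B $ k $ j))" for j
  proof -
    have "?u $ k = (\<Sum>l\<in>UNIV. of_real (C $ i $ l) * matrix_inv ?M $ l $ k)" for k
      unfolding u by (simp add: vector_matrix_mult_def cvec_def mult.commute)
    then show ?thesis
      by (simp add: tf_jw_def matrix_matrix_mult_def cmat_def zero_vec_def)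
  qed
  then have "(cmod (tf_jw A B C 0 \<omega> $ i $ j))\<^sup>2 =
      ((re_resolvent (transpose A) (C $ i) \<omega> v* B) $ j)\<^sup>2 + ((im_resolvent (transpose A) (C $ i) \<omega> v* B) $ j)\<^sup>2" for j
    by (simp add: cmod_power2 vector_matrix_mult_def re_resolvent_def im_resolvent_def sum_negf mult.commute)
  moreover have "(norm x)\<^sup>2 = (\<Sum>j\<in>UNIV. (x $ j)\<^sup>2)" for x :: "real^'w"
    unfolding power2_norm_eq_inner inner_vec_def by (simp add: power2_eq_square)
  ultimately show ?thesis by (simp add: sum.distrib)
qed

lemma h2sq_eq_sum_rows:
  fixes A :: "real^'n^'n" and B :: "real^'w^'n" and C :: "real^'n^'z"
  assumes A: "no_unstable_eigenvalue A"
  shows "h2sq A B C 0 = ennreal (1 / (2 * pi)) * (\<Sum>i\<in>UNIV. \<integral>\<^sup>+ \<omega>.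
    ennreal ((norm (re_resolvent (transpose A) (C $ i) \<omega> v* B))\<^sup>2 + (norm (im_resolvent (transpose A) (C $ i) \<omega> v* B))\<^sup>2) \<partial>lborel)"
proof -
  let ?h = "\<lambda>i \<omega>. (norm (re_resolvent (transpose A) (C $ i) \<omega> v* B))\<^sup>2 + (norm (im_resolvent (transpose A) (C $ i) \<omega> v* B))\<^sup>2"
  have G: "no_unstable_eigenvalue (transpose A)" using A by (rule no_unstable_eigenvalue_transpose)
  have vm: "x v* B = transpose B *v x" for x :: "real^'n" by simp
  have [measurable]: "?h i \<in> borel_measurable borel" for i
    unfolding vm
    by (intro borel_measurable_continuous_onI continuous_intros continuous_on_resolvent[OF G]
        bounded_linear.continuous_on[OF matrix_vector_mul_bounded_linear])
  show ?thesis
  proof -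
    have "ennreal (\<Sum>i\<in>UNIV. ?h i \<omega>) = (\<Sum>i\<in>UNIV. ennreal (?h i \<omega>))" for \<omega>
      by (rule sum_ennreal[symmetric]) simp
    then have "(\<integral>\<^sup>+ \<omega>. ennreal (\<Sum>i\<in>UNIV. ?h i \<omega>) \<partial>lborel) = (\<integral>\<^sup>+ \<omega>. (\<Sum>i\<in>UNIV. ennreal (?h i \<omega>)) \<partial>lborel)"
      by (simp only:)
    also have "\<dots> = (\<Sum>i\<in>UNIV. \<integral>\<^sup>+ \<omega>. ennreal (?h i \<omega>) \<partial>lborel)"
      by (rule nn_integral_sum) measurable
    finally show ?thesis
      unfolding h2sq_def cmod_tf_jw_row[OF A] by (rule arg_cong)
  qed
qed

text \<open>The hypothesis is A P + P A^T + B B^T \<le> 0 read as a quadratic form, so the integrand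
  is dominated by that of \<open>resolvent_lyapunov_integral\<close>, whose integral is known. That
  integrand is nonnegative, which makes \<open>P\<close> semidefinite; equality of the forms gives
  equality of the integrals.\<close>

lemma resolvent_lyapunov_bound:
  fixes A :: "real^'n^'n" and B :: "real^'w^'n"
  assumes A: "no_unstable_eigenvalue A" and P: "transpose P = P"
    and le: "\<And>x. (norm (x v* B))\<^sup>2 \<le> - 2 * (x \<bullet> (A *v (P *v x)))"
  shows "0 \<le> c \<bullet> (P *v c)"
    "(\<integral>\<^sup>+ \<omega>. ennreal ((norm (re_resolvent (transpose A) c \<omega> v* B))\<^sup>2 + (norm (im_resolvent (transpose A) c \<omega> v* B))\<^sup>2) \<partial>lborel)
      \<le> ennreal (2 * pi * (c \<bullet> (P *v c)))" (is "?I \<le> _")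
    "(\<And>x. (norm (x v* B))\<^sup>2 = - 2 * (x \<bullet> (A *v (P *v x)))) \<Longrightarrow>
      (\<integral>\<^sup>+ \<omega>. ennreal ((norm (re_resolvent (transpose A) c \<omega> v* B))\<^sup>2 + (norm (im_resolvent (transpose A) c \<omega> v* B))\<^sup>2) \<partial>lborel)
      = ennreal (2 * pi * (c \<bullet> (P *v c)))"
proof -
  define \<phi> where "\<phi> x = - 2 * (x \<bullet> (A *v (P *v x)))" for x
  let ?p = "re_resolvent (transpose A) c" and ?q = "im_resolvent (transpose A) c"
  have G: "no_unstable_eigenvalue (transpose A)" using A by (rule no_unstable_eigenvalue_transpose)
  obtain J where J: "\<And>N. 0 < N \<Longrightarrow> ((\<lambda>\<omega>. \<phi> (?p \<omega>) + \<phi> (?q \<omega>)) has_integral J N) {- N..N}"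
    "(J \<longlongrightarrow> 2 * pi * (c \<bullet> (P *v c))) at_top"
    unfolding \<phi>_def by (rule resolvent_lyapunov_integral[OF A P, of c]) blast
  have pos: "0 \<le> \<phi> x" for x using le[of x] unfolding \<phi>_def by (meson order_trans zero_le_power2)
  have cont: "continuous_on UNIV (\<lambda>\<omega>. \<phi> (?p \<omega>) + \<phi> (?q \<omega>))"
    unfolding \<phi>_def
    by (intro continuous_intros continuous_on_resolvent[OF G]
        bounded_linear.continuous_on[OF matrix_vector_mul_bounded_linear])
  have int: "(\<integral>\<^sup>+ \<omega>. ennreal (\<phi> (?p \<omega>) + \<phi> (?q \<omega>)) \<partial>lborel) = ennreal (2 * pi * (c \<bullet> (P *v c)))"
    by (rule nn_integral_eq_limit_of_symmetric_integrals[OF cont _ J]) (use pos in auto)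
  have "0 \<le> 2 * pi * (c \<bullet> (P *v c))"
  proof (rule tendsto_lowerbound[OF J(2)])
    show "\<forall>\<^sub>F N in at_top. 0 \<le> J N"
      using eventually_gt_at_top[of "0::real"]
      by eventually_elim (rule has_integral_nonneg[OF J(1)], use pos in auto)
  qed simp
  then show "0 \<le> c \<bullet> (P *v c)" using pi_gt_zero by (auto simp: zero_le_mult_iff)
  have le': "(norm (x v* B))\<^sup>2 \<le> \<phi> x" for x using le by (simp add: \<phi>_def)
  show "?I \<le> ennreal (2 * pi * (c \<bullet> (P *v c)))"
    unfolding int[symmetric] by (intro nn_integral_mono ennreal_leI add_mono le')
  show "?I = ennreal (2 * pi * (c \<bullet> (P *v c)))" if "\<And>x. (norm (x v* B))\<^sup>2 = - 2 * (x \<bullet> (A *v (P *v x)))"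
    unfolding int[symmetric] that \<phi>_def by simp
qed

text \<open>The factor 2 replaces the symmetrization: for symmetric \<open>P\<close>, the forms of A
  P and P A^T coincide. The sum is the trace of C P C^T.\<close>

definition lyap_certificate :: "real^'n^'n \<Rightarrow> real^'w^'n \<Rightarrow> real^'n^'z \<Rightarrow> real \<Rightarrow> real^'n^'n \<Rightarrow> bool" where
  "lyap_certificate A B C \<gamma> P \<longleftrightarrow> pd P \<and>
     (\<forall>x. x \<noteq> 0 \<longrightarrow> 2 * (x \<bullet> (A *v (P *v x))) + (norm (x v* B))\<^sup>2 < 0) \<and>
     (\<Sum>i\<in>UNIV. C $ i \<bullet> (P *v C $ i)) < \<gamma>"

lemma pd_det_nz:
  assumes "pd P" shows "det P \<noteq> 0"
proof (rule det_nz_if_inj)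
  fix x assume "P *v x = 0"
  then show "x = 0" using assms unfolding pd_def by (metis inner_zero_right less_irrefl)
qed

text \<open>An eigenvector is written as P (x + i y). By symmetry of \<open>P\<close> the terms with
  the imaginary part of the eigenvalue cancel, and its real part times a positive number equals a
  negative one.\<close>

lemma hurwitz_if_lyapunov:
  fixes A P :: "real^'n^'n"
  assumes P: "pd P" and neg: "\<And>x. x \<noteq> 0 \<Longrightarrow> x \<bullet> (A *v (P *v x)) < 0"
  shows "hurwitz A"
  unfolding hurwitz_def
proof (intro allI impI)
  fix lam :: complex and v :: "complex^'n"
  assume v: "v \<noteq> 0 \<and> cmat A *v v = lam *s v"
  define a b where "a = (\<chi> i. Re (v $ i))" and "b = (\<chi> i. Im (v $ i))"
  have *: "(\<Sum>j\<in>UNIV. of_real (A $ i $ j) * v $ j) = lam * v $ i" for i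
    using v unfolding vec_eq_iff by (auto simp: matrix_vector_mult_def cmat_def dest: spec[of _ i])
  have Aa: "A *v a = Re lam *\<^sub>R a - Im lam *\<^sub>R b"
    using arg_cong[OF *, of Re] by (simp add: vec_eq_iff a_def b_def matrix_vector_mult_def)
  have Ab: "A *v b = Im lam *\<^sub>R a + Re lam *\<^sub>R b"
    using arg_cong[OF *, of Im] by (simp add: vec_eq_iff a_def b_def matrix_vector_mult_def add.commute)
  define x y where "x = matrix_inv P *v a" and "y = matrix_inv P *v b"
  have a: "a = P *v x" and b: "b = P *v y"
    by (simp_all add: x_def y_def matrix_vector_mul_assoc matrix_inv_right[OF pd_det_nz[OF P]])
  have "x \<bullet> b = y \<bullet> a"
    using P unfolding a b pd_def by (metis inner_matrix_vector_right inner_commute)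
  then have eq: "x \<bullet> (A *v (P *v x)) + y \<bullet> (A *v (P *v y)) = Re lam * (x \<bullet> (P *v x) + y \<bullet> (P *v y))"
    unfolding a[symmetric] b[symmetric] Aa Ab by (simp add: inner_diff_right inner_add_right algebra_simps)
  have "a \<noteq> 0 \<or> b \<noteq> 0"
    using v by (auto simp: a_def b_def vec_eq_iff complex_eq_iff)
  then have nz: "x \<noteq> 0 \<or> y \<noteq> 0" using a b by auto
  have "x \<bullet> (A *v (P *v x)) \<le> 0" "y \<bullet> (A *v (P *v y)) \<le> 0" "0 \<le> x \<bullet> (P *v x)" "0 \<le> y \<bullet> (P *v y)"
    using neg P unfolding pd_def by (metis inner_zero_left less_imp_le order_refl)+
  moreover have "x \<bullet> (A *v (P *v x)) + y \<bullet> (A *v (P *v y)) < 0"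
    using nz calculation neg[of x] neg[of y] by (auto intro: add_neg_nonpos add_nonpos_neg)
  ultimately show "Re lam < 0"
    unfolding eq by (metis add_nonneg_nonneg mult_less_0_iff not_less)
qed

lemma ennreal_two_pi_cancel:
  assumes "\<And>i. 0 \<le> x i"
  shows "ennreal (1 / (2 * pi)) * (\<Sum>i\<in>I. ennreal (2 * pi * x i)) = ennreal (\<Sum>i\<in>I. x i)"
proof -
  have "(\<Sum>i\<in>I. ennreal (2 * pi * x i)) = ennreal (2 * pi * (\<Sum>i\<in>I. x i))"
    unfolding sum_distrib_left by (rule sum_ennreal) (use assms in auto)
  then show ?thesis
    using assms by (simp add: sum_nonneg flip: ennreal_mult)
qed

text \<open>Conversely to the integral bound, the Gramian \<open>P0\<close> solves the equation and
  attains the norm exactly. Adding a small multiple of \<open>P1\<close>, the solution with right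
  side -I, makes the inequality strict at a controlled cost.\<close>

lemma hurwitz_h2sq_less_iff_certificate:
  fixes A :: "real^'n^'n" and B :: "real^'w^'n" and C :: "real^'n^'z"
  shows "hurwitz A \<and> h2sq A B C 0 < ennreal \<gamma> \<longleftrightarrow> (\<exists>P. lyap_certificate A B C \<gamma> P)"
proof
  assume "\<exists>P. lyap_certificate A B C \<gamma> P"
  then obtain P where P: "pd P" "\<And>x. x \<noteq> 0 \<Longrightarrow> 2 * (x \<bullet> (A *v (P *v x))) + (norm (x v* B))\<^sup>2 < 0"
    and tr: "(\<Sum>i\<in>UNIV. C $ i \<bullet> (P *v C $ i)) < \<gamma>"
    unfolding lyap_certificate_def by blast
  have hur: "hurwitz A"
  proof (rule hurwitz_if_lyapunov[OF P(1)])
    fix x :: "real^'n" assume "x \<noteq> 0"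
    from P(2)[OF this] show "x \<bullet> (A *v (P *v x)) < 0"
      using zero_le_power2[of "norm (x v* B)"] by linarith
  qed
  then have A: "no_unstable_eigenvalue A" by (simp add: hurwitz_iff_no_unstable_eigenvalue)
  have sym: "transpose P = P" using P(1) by (simp add: pd_def)
  have le: "(norm (x v* B))\<^sup>2 \<le> - 2 * (x \<bullet> (A *v (P *v x)))" for x
    by (cases "x = 0") (use P(2)[of x] in auto)
  note bound = resolvent_lyapunov_bound[OF A sym le]
  have "h2sq A B C 0 \<le> ennreal (1 / (2 * pi)) * (\<Sum>i\<in>UNIV. ennreal (2 * pi * (C $ i \<bullet> (P *v C $ i))))"
    unfolding h2sq_eq_sum_rows[OF A] by (intro mult_left_mono sum_mono bound(2)) auto
  also have "\<dots> = ennreal (\<Sum>i\<in>UNIV. C $ i \<bullet> (P *v C $ i))"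
    by (rule ennreal_two_pi_cancel[OF bound(1)])
  also have "\<dots> < ennreal \<gamma>"
    using le_less_trans[OF sum_nonneg[OF bound(1)] tr] tr by (rule ennreal_lessI)
  finally show "hurwitz A \<and> h2sq A B C 0 < ennreal \<gamma>" using hur by blast
next
  assume *: "hurwitz A \<and> h2sq A B C 0 < ennreal \<gamma>"
  then have A: "no_unstable_eigenvalue A" by (simp add: hurwitz_iff_no_unstable_eigenvalue)
  have "transpose (- (B ** transpose B)) = - (B ** transpose B)"
    by (simp add: matrix_transpose_mul transpose_uminus)
  then obtain P0 where P0: "transpose P0 = P0" "A ** P0 + P0 ** transpose A = - (B ** transpose B)"
    using lyapunov_solution[OF A] by blast
  have "transpose (- mat 1 :: real^'n^'n) = - mat 1" by (simp add: transpose_uminus)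
  then obtain P1 where P1: "transpose P1 = P1" "A ** P1 + P1 ** transpose A = - mat 1"
    using lyapunov_solution[OF A] by blast
  have quad: "2 * (x \<bullet> (A *v (P *v x))) = x \<bullet> ((A ** P + P ** transpose A) *v x)" if "transpose P = P" for P x
  proof -
    have "x \<bullet> ((P ** transpose A) *v x) = x \<bullet> ((A ** P) *v x)"
      by (subst inner_matrix_vector_right) (simp add: matrix_transpose_mul that inner_commute)
    then show ?thesis
      by (simp add: matrix_vector_mult_add_rdistrib inner_add_right matrix_vector_mul_assoc)
  qed
  have eq0: "(norm (x v* B))\<^sup>2 = - 2 * (x \<bullet> (A *v (P0 *v x)))" for x
  proof -
    have "- 2 * (x \<bullet> (A *v (P0 *v x))) = x \<bullet> ((B ** transpose B) *v x)"
      using quad[OF P0(1), of x] unfolding P0(2) by (simp add: matrix_vector_mult_minus_left)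
    also have "\<dots> = (transpose B *v x) \<bullet> (transpose B *v x)"
      unfolding matrix_vector_mul_assoc[symmetric] by (rule inner_matrix_vector_right)
    finally show ?thesis by (simp add: power2_norm_eq_inner)
  qed
  have eq1: "(norm (x v* (mat 1 :: real^'n^'n)))\<^sup>2 = - 2 * (x \<bullet> (A *v (P1 *v x)))" for x
    using quad[OF P1(1), of x] unfolding P1(2) by (simp add: matrix_vector_mult_minus_left power2_norm_eq_inner)
  note b0 = resolvent_lyapunov_bound[OF A P0(1) eq_refl[OF eq0]]
  note b1 = resolvent_lyapunov_bound[OF A P1(1) eq_refl[OF eq1]]
  define t0 t1 where "t0 = (\<Sum>i\<in>UNIV. C $ i \<bullet> (P0 *v C $ i))" and "t1 = (\<Sum>i\<in>UNIV. C $ i \<bullet> (P1 *v C $ i))"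
  have "h2sq A B C 0 = ennreal (1 / (2 * pi)) * (\<Sum>i\<in>UNIV. ennreal (2 * pi * (C $ i \<bullet> (P0 *v C $ i))))"
    unfolding h2sq_eq_sum_rows[OF A] b0(3)[OF eq0] ..
  also have "\<dots> = ennreal t0"
    unfolding t0_def by (rule ennreal_two_pi_cancel[OF b0(1)])
  finally have t0: "t0 < \<gamma>"
    using * by (metis ennreal_leI not_less)
  have t1: "0 \<le> t1" unfolding t1_def by (intro sum_nonneg b1(1))
  \<comment> \<open>The gap to \<gamma> is spread so that e t1 stays below it; the 1 in the
    denominator covers t1 = 0.\<close>
  define e where "e = (\<gamma> - t0) / (t1 + 1)"
  have e: "0 < e" "t0 + e * t1 < \<gamma>"
    using t0 t1 by (auto simp: e_def field_simps)
  define P where "P = P0 + e *\<^sub>R P1"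
  have sym: "transpose P = P"
    by (simp add: P_def transpose_add transpose_scalar P0 P1 flip: scalar_mult_eq_scaleR)
  have Px: "P *v x = P0 *v x + e *\<^sub>R (P1 *v x)" for x
    by (simp add: P_def matrix_vector_mult_add_rdistrib scaleR_matrix_vector_assoc)
  have neg: "2 * (x \<bullet> (A *v (P *v x))) + (norm (x v* B))\<^sup>2 < 0" if "x \<noteq> 0" for x
  proof -
    have "2 * (x \<bullet> (A *v (P *v x))) + (norm (x v* B))\<^sup>2 = - (e * (norm x)\<^sup>2)"
      using eq0[of x] eq1[of x]
      by (simp add: Px matrix_vector_right_distrib matrix_vector_mult_scaleR inner_add_right algebra_simps)
    then show ?thesis using e that by simp
  qed
  have ge: "0 \<le> x \<bullet> (P *v x)" for x
    using b0(1)[of x] b1(1)[of x] e by (simp add: Px inner_add_right)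
  \<comment> \<open>Semidefiniteness comes from the integrals; a kernel vector would remove the only
    term of the strict inequality that can be negative.\<close>
  have "pd P"
    unfolding pd_def
  proof (intro conjI sym allI impI)
    fix x :: "real^'n" assume x: "x \<noteq> 0"
    show "0 < x \<bullet> (P *v x)"
    proof (rule ccontr)
      assume "\<not> 0 < x \<bullet> (P *v x)"
      then have 0: "x \<bullet> (P *v x) = 0" using ge[of x] by linarith
      text \<open>A zero of the nonnegative form is a minimum, so it lies in the kernel of \<open>P\<close>.\<close>
      have "P *v x = 0"
      proof (rule ccontr)
        assume "P *v x \<noteq> 0"
        define n w where "n = (P *v x) \<bullet> (P *v x)" and "w = (P *v x) \<bullet> (P *v (P *v x))"
        have n: "0 < n" using \<open>P *v x \<noteq> 0\<close> by (simp add: n_def)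
        have w: "0 \<le> w" unfolding w_def by (rule ge)
        \<comment> \<open>Moving from x by -s P x changes the form by s (s w - 2 n), negative for
          small s; the 1 covers w = 0.\<close>
        define s where "s = n / (w + 1)"
        have s: "0 < s" "s * w < 2 * n" using n w by (auto simp: s_def field_simps intro: add_nonneg_pos)
        have xP: "x \<bullet> (P *v (P *v x)) = n"
          by (subst inner_matrix_vector_right) (simp add: sym n_def)
        have "(x - s *\<^sub>R (P *v x)) \<bullet> (P *v (x - s *\<^sub>R (P *v x))) = s * (s * w - 2 * n)"
          using 0 xP by (simp add: matrix_vector_mult_diff_distrib matrix_vector_mult_scaleR inner_diff_left
              inner_diff_right n_def[symmetric] w_def[symmetric] algebra_simps)
        moreover have "s * (s * w - 2 * n) < 0" using s by (simp add: mult_pos_neg)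
        ultimately show False using ge[of "x - s *\<^sub>R (P *v x)"] by linarith
      qed
      then have "0 \<le> 2 * (x \<bullet> (A *v (P *v x))) + (norm (x v* B))\<^sup>2" by simp
      then show False using neg[OF x] by linarith
    qed
  qed
  moreover have "(\<Sum>i\<in>UNIV. C $ i \<bullet> (P *v C $ i)) < \<gamma>"
    using e(2) by (simp add: Px inner_add_right sum.distrib t0_def t1_def sum_distrib_left)
  ultimately show "\<exists>P. lyap_certificate A B C \<gamma> P"
    unfolding lyap_certificate_def using neg by blast
qed

section \<open>Block matrices, perturbation and similarity\<close>

definition pairv :: "'a^'m \<Rightarrow> 'a^'n \<Rightarrow> 'a^('m + 'n)" where
  "pairv a b = (\<chi> i. case i of Inl j \<Rightarrow> a $ j | Inr j \<Rightarrow> b $ j)"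

lemma pairv_nth [simp]: "pairv a b $ Inl i = a $ i" "pairv a b $ Inr j = b $ j"
  by (simp_all add: pairv_def)

lemma vec_eq_iff_sum: "x = y \<longleftrightarrow> (\<forall>i. x $ Inl i = y $ Inl i) \<and> (\<forall>j. x $ Inr j = y $ Inr j)"
  unfolding vec_eq_iff by (metis sum.exhaust)

lemma pairv_cases: obtains a b where "x = pairv a b"
proof
  show "x = pairv (\<chi> i. x $ Inl i) (\<chi> j. x $ Inr j)" by (simp add: vec_eq_iff_sum)
qed

lemma pairv_eq_iff [simp]: "pairv a b = pairv c d \<longleftrightarrow> a = c \<and> b = d"
  unfolding vec_eq_iff_sum by (simp add: vec_eq_iff)

lemma pairv_eq_0_iff [simp]: "pairv a b = 0 \<longleftrightarrow> a = 0 \<and> b = 0"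
  unfolding vec_eq_iff_sum by (simp add: vec_eq_iff)

lemma sum_UNIV_Plus:
  "(\<Sum>i\<in>UNIV. f i) = (\<Sum>i\<in>UNIV. f (Inl (i :: 'a::finite))) + (\<Sum>j\<in>UNIV. f (Inr (j :: 'b::finite)))"
  unfolding UNIV_Plus_UNIV[symmetric] by (subst sum.Plus) auto

lemma blk_nth [simp]:
  "blk M N K L $ Inl i $ Inl j = M $ i $ j" "blk M N K L $ Inl i $ Inr j' = N $ i $ j'"
  "blk M N K L $ Inr i' $ Inl j = K $ i' $ j" "blk M N K L $ Inr i' $ Inr j' = L $ i' $ j'"
  by (simp_all add: blk_def vcat_def hcat_def)

lemma inner_pairv [simp]: "pairv a b \<bullet> pairv c d = a \<bullet> c + b \<bullet> (d :: real^'n)"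
  by (simp add: inner_vec_def sum_UNIV_Plus)

lemma blk_mult_pairv [simp]: "blk M N K L *v pairv a b = pairv (M *v a + N *v b) (K *v a + L *v b)"
  by (simp add: vec_eq_iff_sum matrix_vector_mult_def sum_UNIV_Plus)

lemma pairv_mult_vcat [simp]: "pairv a b v* vcat M N = a v* M + b v* (N :: real^'k^'n)"
  by (simp add: vec_eq_iff vector_matrix_mult_def sum_UNIV_Plus vcat_def)

lemma hcat_row [simp]: "hcat M N $ i = pairv (M $ i) (N $ i)"
  by (simp add: vec_eq_iff_sum hcat_def)

lemma blk_eqI:
  assumes "\<And>i j. M $ Inl i $ Inl j = N $ Inl i $ Inl j" "\<And>i j. M $ Inl i $ Inr j = N $ Inl i $ Inr j"
    "\<And>i j. M $ Inr i $ Inl j = N $ Inr i $ Inl j" "\<And>i j. M $ Inr i $ Inr j = N $ Inr i $ Inr j"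
  shows "M = N"
  using assms by (simp add: vec_eq_iff_sum)

lemma blk_mult: "blk M N K L ** blk M' N' K' L' =
    blk (M ** M' + N ** K') (M ** N' + N ** L') (K ** M' + L ** K') (K ** N' + L ** L')"
  by (rule blk_eqI) (simp_all add: matrix_matrix_mult_def sum_UNIV_Plus)

lemma blk_mult_vcat: "blk M N K L ** vcat M' N' = vcat (M ** M' + N ** N') (K ** M' + L ** N')"
  by (simp add: vec_eq_iff_sum) (simp add: vec_eq_iff matrix_matrix_mult_def sum_UNIV_Plus vcat_def)

lemma hcat_mult_blk: "hcat M N ** blk M' N' K' L' = hcat (M ** M' + N ** K') (M ** N' + N ** L')"
  unfolding vec_eq_iff
proof (intro allI)
  fix i j
  show "(hcat M N ** blk M' N' K' L') $ i $ j = hcat (M ** M' + N ** K') (M ** N' + N ** L') $ i $ j"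
    by (cases j) (simp_all add: matrix_matrix_mult_def sum_UNIV_Plus)
qed

lemma transpose_blk: "transpose (blk M N K L) = blk (transpose M) (transpose K) (transpose N) (transpose L)"
  by (rule blk_eqI) (simp_all add: transpose_def)

lemma blk_one: "blk (mat 1) 0 0 (mat 1) = mat 1"
  by (rule blk_eqI) (simp_all add: mat_def)

lemma blk_cases: obtains M N K L where "X = blk M N K L"
proof
  show "X = blk (\<chi> i j. X $ Inl i $ Inl j) (\<chi> i j. X $ Inl i $ Inr j)
    (\<chi> i j. X $ Inr i $ Inl j) (\<chi> i j. X $ Inr i $ Inr j)"
    by (rule blk_eqI) simp_all
qed

lemma blk_eq_iff [simp]: "blk M N K L = blk M' N' K' L' \<longleftrightarrow> M = M' \<and> N = N' \<and> K = K' \<and> L = L'"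
  by (metis (no_types, lifting) blk_nth vec_eq_iff)

lemma blk_add_scaleR: "blk M N K L + t *\<^sub>R blk M' N' K' L' =
    blk (M + t *\<^sub>R M') (N + t *\<^sub>R N') (K + t *\<^sub>R K') (L + t *\<^sub>R L')"
  by (rule blk_eqI) simp_all

lemma of_blk [simp]:
  "DKof (blk M N K L) = M" "CKof (blk M N K L) = N" "BKof (blk M N K L) = K" "AKof (blk M N K L) = L"
  by (simp_all add: DKof_def CKof_def BKof_def AKof_def vec_eq_iff)

lemma controller_eq_blk: "K = blk (DKof K) (CKof K) (BKof K) (AKof K)"
  by (rule blk_cases[of K]) simp

section \<open>Openness of strict inequalities and perturbation of certificates\<close>

lemma eventually_pos_perturb:
  fixes M E :: "real^'n^'n"
  assumes M: "\<And>x. x \<noteq> 0 \<Longrightarrow> 0 < x \<bullet> (M *v x)"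
  shows "\<forall>\<^sub>F t in at_right 0. \<forall>x. x \<noteq> 0 \<longrightarrow> 0 < x \<bullet> ((M + t *\<^sub>R E) *v x)"
proof -
  \<comment> \<open>The minimum over the compact unit sphere is a uniform margin; homogeneity
    extends it to all vectors.\<close>
  have "continuous_on (sphere 0 1) (\<lambda>x. x \<bullet> (M *v x))"
    by (intro continuous_intros bounded_linear.continuous_on[OF matrix_vector_mul_bounded_linear])
  moreover have "axis undefined 1 \<in> sphere (0 :: real^'n) 1" by simp
  ultimately obtain z where z: "z \<in> sphere 0 1" "\<And>x. x \<in> sphere 0 1 \<Longrightarrow> z \<bullet> (M *v z) \<le> x \<bullet> (M *v x)"
    using continuous_attains_inf[of "sphere 0 1" "\<lambda>x. x \<bullet> (M *v x)"] by (metis compact_sphere empty_iff)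
  define m where "m = z \<bullet> (M *v z)"
  have m: "0 < m" using M[of z] z(1) unfolding m_def by fastforce
  obtain B where B: "B > 0" "\<And>x. norm (E *v x) \<le> B * norm x"
    using linear_bounded_pos[OF matrix_vector_mul_linear] by metis
  have "\<forall>\<^sub>F t in at_right 0. t < m / B"
    using m B(1) by (intro eventually_at_right_less order_tendstoD[OF tendsto_ident_at]) auto
  moreover have "\<forall>\<^sub>F t in at_right (0::real). 0 < t" by (rule eventually_at_right_less)
  ultimately show ?thesis
  proof eventually_elim
    case (elim t)
    show ?case
    proof (intro allI impI)
      fix x :: "real^'n" assume x: "x \<noteq> 0"
      define y where "y = x /\<^sub>R norm x"
      have y: "norm y = 1" "x = norm x *\<^sub>R y" using x by (simp_all add: y_def)
      have "\<bar>y \<bullet> (E *v y)\<bar> \<le> norm y * norm (E *v y)" by (rule Cauchy_Schwarz_ineq2)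
      then have "- B \<le> y \<bullet> (E *v y)" using B(2)[of y] y(1) by simp
      then have "t * (- B) \<le> t * (y \<bullet> (E *v y))" using elim by (intro mult_left_mono) auto
      moreover have "t * B < m" using elim B(1) by (simp add: field_simps)
      moreover have "m \<le> y \<bullet> (M *v y)" using z(2)[of y] y(1) by (simp add: m_def)
      ultimately have "0 < y \<bullet> (M *v y) + t * (y \<bullet> (E *v y))" by simp
      then have "0 < y \<bullet> ((M + t *\<^sub>R E) *v y)"
        by (simp add: matrix_vector_mult_add_rdistrib inner_add_right flip: scaleR_matrix_vector_assoc)
      moreover have "x \<bullet> ((M + t *\<^sub>R E) *v x) = (norm x)\<^sup>2 * (y \<bullet> ((M + t *\<^sub>R E) *v y))"
        by (subst (1 2) y(2)) (simp add: matrix_vector_mult_scaleR power2_eq_square)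
      ultimately show "0 < x \<bullet> ((M + t *\<^sub>R E) *v x)" using x by simp
    qed
  qed
qed

text \<open>All clauses are strict, hence survive small shifts; a symmetric \<open>E\<close>
  preserves the symmetry of \<open>P\<close>.\<close>

lemma eventually_lyap_certificate_perturb:
  fixes A :: "real^'n^'n" and B :: "real^'w^'n" and C :: "real^'n^'z"
  assumes P: "lyap_certificate A B C \<gamma> P" and E: "transpose E = E"
  shows "\<forall>\<^sub>F t in at_right 0. lyap_certificate A B C \<gamma> (P + t *\<^sub>R E)"
proof -
  have P': "pd P" "\<And>x. x \<noteq> 0 \<Longrightarrow> 2 * (x \<bullet> (A *v (P *v x))) + (norm (x v* B))\<^sup>2 < 0"
    "(\<Sum>i\<in>UNIV. C $ i \<bullet> (P *v C $ i)) < \<gamma>"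
    using P by (auto simp: lyap_certificate_def)
  have 1: "\<forall>\<^sub>F t in at_right 0. \<forall>x. x \<noteq> 0 \<longrightarrow> 0 < x \<bullet> ((P + t *\<^sub>R E) *v x)"
    using P'(1) by (intro eventually_pos_perturb) (auto simp: pd_def)
  \<comment> \<open>The negated Lyapunov form, left unsymmetrized:
    \<open>eventually_pos_perturb\<close> only looks at the quadratic form.\<close>
  define M where "M = - (2 *\<^sub>R (A ** P) + B ** transpose B)"
  have BB: "x \<bullet> (B *v (x v* B)) = (norm (x v* B))\<^sup>2" for x
    by (simp add: power2_norm_eq_inner flip: dot_lmul_matrix)
  have M: "x \<bullet> ((M + t *\<^sub>R (- 2 *\<^sub>R (A ** E))) *v x) = - (2 * (x \<bullet> (A *v ((P + t *\<^sub>R E) *v x))) + (norm (x v* B))\<^sup>2)" for x t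
    by (simp add: M_def matrix_vector_mult_add_rdistrib matrix_vector_mult_minus_left inner_add_right
        matrix_vector_mult_diff_rdistrib inner_diff_right matrix_vector_right_distrib matrix_vector_mult_scaleR BB
        flip: scaleR_matrix_vector_assoc matrix_vector_mul_assoc)
  have 2: "\<forall>\<^sub>F t in at_right 0. \<forall>x. x \<noteq> 0 \<longrightarrow> 0 < x \<bullet> ((M + t *\<^sub>R (- 2 *\<^sub>R (A ** E))) *v x)"
  proof (rule eventually_pos_perturb)
    fix x :: "real^'n" assume "x \<noteq> 0"
    then show "0 < x \<bullet> (M *v x)" using M[of x 0] P'(2)[of x] by simp
  qed
  have "((\<lambda>t. \<Sum>i\<in>UNIV. C $ i \<bullet> (P *v C $ i) + t * (C $ i \<bullet> (E *v C $ i))) \<longlongrightarrow>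
      (\<Sum>i\<in>UNIV. C $ i \<bullet> (P *v C $ i) + 0 * (C $ i \<bullet> (E *v C $ i)))) (at_right 0)"
    by (intro tendsto_intros)
  then have 3: "\<forall>\<^sub>F t in at_right 0. (\<Sum>i\<in>UNIV. C $ i \<bullet> (P *v C $ i) + t * (C $ i \<bullet> (E *v C $ i))) < \<gamma>"
    by (rule order_tendstoD(2)) (use P'(3) in simp)
  from 1 2 3 show ?thesis
  proof eventually_elim
    case (elim t)
    have "transpose (P + t *\<^sub>R E) = P + t *\<^sub>R E"
      using P'(1) E by (simp add: transpose_add transpose_scalar pd_def)
    moreover have "\<forall>x. x \<noteq> 0 \<longrightarrow> 2 * (x \<bullet> (A *v ((P + t *\<^sub>R E) *v x))) + (norm (x v* B))\<^sup>2 < 0"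
      using elim(2) unfolding M neg_0_less_iff_less .
    ultimately show ?case
      using elim(1,3) unfolding lyap_certificate_def pd_def
      by (simp add: matrix_vector_mult_add_rdistrib inner_add_right flip: scaleR_matrix_vector_assoc)
  qed
qed

lemma eventually_det_shift_nz:
  fixes M :: "real^'n^'n"
  shows "\<forall>\<^sub>F t in at_right 0. det (M + t *\<^sub>R mat 1) \<noteq> 0"
proof -
  \<comment> \<open>the shifted determinant as a polynomial in the shift; it is nonzero for large shifts\<close>
  define p where "p = det (\<chi> i j. [:M $ i $ j, mat 1 $ i $ j:])"
  have p: "poly p t = det (M + t *\<^sub>R mat 1)" for t
    unfolding p_def det_def by (simp add: poly_sum poly_prod)
  obtain B where B: "B > 0" "\<And>x. norm (M *v x) \<le> B * norm x"
    using linear_bounded_pos[OF matrix_vector_mul_linear] by metis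
  have "det (M + (B + 1) *\<^sub>R mat 1) \<noteq> 0"
  proof (rule det_nz_if_inj)
    fix x assume "(M + (B + 1) *\<^sub>R mat 1) *v x = 0"
    then have "M *v x = - ((B + 1) *\<^sub>R x)"
      by (simp add: matrix_vector_mult_add_rdistrib add_eq_0_iff flip: scaleR_matrix_vector_assoc)
    then have "(B + 1) * norm x \<le> B * norm x"
      using B(2)[of x] B(1) by simp
    then show "x = 0" by (simp add: algebra_simps)
  qed
  then have "p \<noteq> 0" using p by (metis poly_0)
  then have fin: "finite {t. poly p t = 0}" by (rule poly_roots_finite)
  then have "\<forall>\<^sub>F t in at_right 0. t \<notin> {t. poly p t = 0}"
    using islimpt_finite[OF fin, of 0] unfolding islimpt_iff_eventually by (simp add: eventually_at_split)
  then show ?thesis by (simp add: p)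
qed

text \<open>Both quadratic forms are pulled back along the injective map sending x to U^T x, and the
  trace is a coordinate-free quantity.\<close>

lemma lyap_certificate_similarity:
  fixes A U U' :: "real^'n^'n" and B :: "real^'w^'n" and C :: "real^'n^'z"
  assumes P: "lyap_certificate A B C \<gamma> P" and U: "U' ** U = mat 1"
  shows "lyap_certificate (U ** A ** U') (U ** B) (C ** U') \<gamma> (U ** P ** transpose U)"
proof -
  have P': "transpose P = P" "\<And>x. x \<noteq> 0 \<Longrightarrow> 0 < x \<bullet> (P *v x)"
    "\<And>x. x \<noteq> 0 \<Longrightarrow> 2 * (x \<bullet> (A *v (P *v x))) + (norm (x v* B))\<^sup>2 < 0"
    "(\<Sum>i\<in>UNIV. C $ i \<bullet> (P *v C $ i)) < \<gamma>"
    using P by (auto simp: lyap_certificate_def pd_def)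
  have U2: "U ** U' = mat 1" using U matrix_left_right_inverse by blast
  have nz: "x v* U \<noteq> 0" if "x \<noteq> 0" for x
    using that U2 by (metis vector_matrix_mul_assoc vector_matrix_mul_rid vector_matrix_mult_0)
  have quad: "x \<bullet> ((U ** P ** transpose U) *v x) = (x v* U) \<bullet> (P *v (x v* U))" for x
    by (simp add: dot_lmul_matrix flip: matrix_vector_mul_assoc)
  have U'U: "U' *v (U *v x) = x" for x by (simp add: matrix_vector_mul_assoc U)
  have lin: "x \<bullet> ((U ** A ** U') *v ((U ** P ** transpose U) *v x)) = (x v* U) \<bullet> (A *v (P *v (x v* U)))" for x
    by (simp add: dot_lmul_matrix U'U flip: matrix_vector_mul_assoc)
  have row: "(C ** U') $ i = C $ i v* U'" for i
    by (simp add: vec_eq_iff matrix_matrix_mult_def vector_matrix_mult_def mult.commute)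
  have "(C ** U') $ i \<bullet> ((U ** P ** transpose U) *v (C ** U') $ i) = C $ i \<bullet> (P *v C $ i)" for i
    unfolding quad unfolding row vector_matrix_mul_assoc U by simp
  moreover have "transpose (U ** P ** transpose U) = U ** P ** transpose U"
    by (simp add: matrix_transpose_mul P'(1) matrix_mul_assoc)
  ultimately show ?thesis
    unfolding lyap_certificate_def pd_def quad lin
    using P' nz by (simp flip: vector_matrix_mul_assoc)
qed

section \<open>Linearizing change of variables\<close>

locale plant =
  fixes A :: "real^'n^'n" and B2 :: "real^'u^'n" and C2 :: "real^'n^'y"
    and B1 :: "real^('n + 'y)^'n" and D21 :: "real^('n + 'y)^'y" and C1 :: "real^'n^'z" and D12 :: "real^'u^'z"
    and \<gamma> :: real
begin

definition cert :: "real^('y + 'n)^('u + 'n) \<Rightarrow> real^('n + 'n)^('n + 'n) \<Rightarrow> bool" where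
  "cert K P \<longleftrightarrow> lyap_certificate (Acl A B2 C2 K) (Bcl B2 B1 D21 K) (Ccl C1 D12 C2 K) \<gamma> P"

definition certified :: "(real^('y + 'n)^('u + 'n)) set" where
  "certified = {K. DKof K = 0 \<and> (\<exists>P. cert K P)}"

text \<open>Certificates of this shape arise when the plant state is the sum of the controller state
  and an uncorrelated estimation error.\<close>

definition normalized :: "(real^('y + 'n)^('u + 'n)) set" where
  "normalized = {K. DKof K = 0 \<and> (\<exists>X Z. cert K (blk X Z Z Z))}"

text \<open>The quadratic form of the coupling matrix [Y I; I X].\<close>

definition lmi_gram :: "real^'n^'n \<Rightarrow> real^'n^'n \<Rightarrow> real^'n \<Rightarrow> real^'n \<Rightarrow> real" where
  "lmi_gram X Y a b = a \<bullet> (Y *v a) + 2 * (a \<bullet> b) + b \<bullet> (X *v b)"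

definition lmi_noise :: "real^'n^'n \<Rightarrow> real^'y^'n \<Rightarrow> real^'n \<Rightarrow> real^'n \<Rightarrow> real^('n + 'y)" where
  "lmi_noise Y Bh a b = (Y *v a + b) v* B1 - (a v* Bh) v* D21"

text \<open>Half of the symmetric Lyapunov form. Products of controller and certificate are absorbed
  into \<open>Ah\<close>, \<open>Bh\<close> and \<open>Ch\<close>, which leaves every term affine in
  the unknowns.\<close>

definition lmi_drift :: "real^'n^'n \<Rightarrow> real^'n^'n \<Rightarrow> real^'n^'n \<Rightarrow> real^'y^'n \<Rightarrow> real^'n^'u \<Rightarrow> real^'n \<Rightarrow> real^'n \<Rightarrow> real" where
  "lmi_drift X Y Ah Bh Ch a b = a \<bullet> (Y *v (A *v a)) - a \<bullet> (Bh *v (C2 *v a)) + a \<bullet> (Ah *v b)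
     + b \<bullet> (A *v a) + b \<bullet> (A *v (X *v b)) + b \<bullet> (B2 *v (Ch *v b))"

definition lmi_output :: "real^'n^'n \<Rightarrow> real^'n^'u \<Rightarrow> real^'n \<Rightarrow> real^'n \<Rightarrow> real^'z" where
  "lmi_output X Ch a b = C1 *v (a + X *v b) + D12 *v (Ch *v b)"

text \<open>The last clause bounds the trace of \<open>C \<Theta>\<^sup>-\<^sup>1 C\<^sup>T\<close> through
  \<open>c \<bullet> \<Theta>\<^sup>-\<^sup>1 c = sup\<^sub>w (2 c \<bullet> w - w \<bullet> \<Theta> w)\<close>, which makes its joint convexity evident.\<close>

definition lmi_set :: "((real^'n^'n) \<times> (real^'n^'n) \<times> (real^'n^'n) \<times> (real^'y^'n) \<times> (real^'n^'u)) set" where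
  "lmi_set = {(X, Y, Ah, Bh, Ch). transpose X = X \<and> transpose Y = Y \<and>
     (\<forall>a b. (a, b) \<noteq> 0 \<longrightarrow> 0 < lmi_gram X Y a b) \<and>
     (\<forall>a b. (a, b) \<noteq> 0 \<longrightarrow> 2 * lmi_drift X Y Ah Bh Ch a b + (norm (lmi_noise Y Bh a b))\<^sup>2 < 0) \<and>
     (\<exists>g. (\<Sum>i\<in>UNIV. g i) < \<gamma> \<and> (\<forall>i a b. 2 * (lmi_output X Ch a b $ i) - lmi_gram X Y a b \<le> g i))}"

text \<open>Solves the equations for \<open>Ch\<close>, \<open>Bh\<close>, \<open>Ah\<close> in
  \<open>cert_iff_lmi\<close> for the controller. \<open>S\<close> plays the role of the error
  covariance, X - S that of the covariance Z of the controller state.\<close>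

definition controller_of_lmi ::
  "(real^'n^'n) \<times> (real^'n^'n) \<times> (real^'n^'n) \<times> (real^'y^'n) \<times> (real^'n^'u) \<Rightarrow> real^('y + 'n)^('u + 'n)" where
  "controller_of_lmi = (\<lambda>(X, Y, Ah, Bh, Ch).
     let S = matrix_inv Y; Z' = matrix_inv (X - S) in
     blk 0 (Ch ** Z') (S ** Bh) ((A ** X + B2 ** Ch - S ** Bh ** C2 ** X - S ** Ah) ** Z'))"

lemma closed_loop_blk:
  "Acl A B2 C2 (blk 0 Kc L AK) = blk A (B2 ** Kc) (L ** C2) AK"
  "Bcl B2 B1 D21 (blk 0 Kc L AK) = vcat B1 (L ** D21)"
  "Ccl C1 D12 C2 (blk 0 Kc L AK) = hcat C1 (D12 ** Kc)"
  by (simp_all add: Acl_def Bcl_def Ccl_def)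

lemma norm_power2_convex:
  fixes x y :: "'a::real_inner"
  assumes "0 \<le> u" "0 \<le> v" "u + v = 1"
  shows "(norm (u *\<^sub>R x + v *\<^sub>R y))\<^sup>2 \<le> u * (norm x)\<^sup>2 + v * (norm y)\<^sup>2"
proof -
  have v: "v = 1 - u" using assms(3) by simp
  have "u * (norm x)\<^sup>2 + v * (norm y)\<^sup>2 - (norm (u *\<^sub>R x + v *\<^sub>R y))\<^sup>2 = u * v * (norm (x - y))\<^sup>2"
    unfolding power2_norm_eq_inner v
    by (simp add: inner_add_left inner_add_right inner_diff_left inner_diff_right inner_commute algebra_simps)
  moreover have "0 \<le> u * v * (norm (x - y))\<^sup>2" using assms by simp
  ultimately show ?thesis by linarith
qed

text \<open>Gram, drift, noise and output are affine in the unknowns. The only nonlinearity is the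
  squared norm of the noise, which is convex and on the correct side; the cost clause is a family of
  affine inequalities.\<close>

lemma convex_lmi_set: "convex lmi_set"
proof (rule convexI)
  fix p q u v assume pq: "p \<in> lmi_set" "q \<in> lmi_set" and uv: "0 \<le> u" "0 \<le> v" "u + v = (1::real)"
  obtain X Y Ah Bh Ch where p: "p = (X, Y, Ah, Bh, Ch)" by (metis prod_cases5)
  obtain X' Y' Ah' Bh' Ch' where q: "q = (X', Y', Ah', Bh', Ch')" by (metis prod_cases5)
  note P = pq(1)[unfolded p lmi_set_def, simplified]
  note Q = pq(2)[unfolded q lmi_set_def, simplified]
  have v: "v = 1 - u" using uv(3) by simp
  have lin: "(u *\<^sub>R M + v *\<^sub>R N) *v x = u *\<^sub>R (M *v x) + v *\<^sub>R (N *v x)"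
    for M N :: "real^'k^'l" and x
    by (simp add: matrix_vector_mult_add_rdistrib flip: scaleR_matrix_vector_assoc)
  have lin': "x v* (u *\<^sub>R M + v *\<^sub>R N) = u *\<^sub>R (x v* M) + v *\<^sub>R (x v* N)"
    for M N :: "real^'l^'k" and x
    by (simp add: vec_eq_iff vector_matrix_mult_def sum.distrib sum_distrib_left algebra_simps)
  have lin'': "(u *\<^sub>R x + v *\<^sub>R y) v* M = u *\<^sub>R (x v* M) + v *\<^sub>R (y v* M)"
    for M :: "real^'l^'k" and x y
    by (simp add: vec_eq_iff vector_matrix_mult_def sum.distrib sum_distrib_left algebra_simps)
  have gram: "lmi_gram (u *\<^sub>R X + v *\<^sub>R X') (u *\<^sub>R Y + v *\<^sub>R Y') a b = u * lmi_gram X Y a b + v * lmi_gram X' Y' a b" for a b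
  proof -
    \<comment> \<open>Terms free of the unknowns are split by u + v = 1; this is where the maps are
      affine and not linear.\<close>
    have ab: "a \<bullet> b = u * (a \<bullet> b) + v * (a \<bullet> b)" by (simp add: v algebra_simps)
    show ?thesis
      unfolding lmi_gram_def lin by (subst ab) (simp add: inner_add_right ring_distribs)
  qed
  have drift: "lmi_drift (u *\<^sub>R X + v *\<^sub>R X') (u *\<^sub>R Y + v *\<^sub>R Y') (u *\<^sub>R Ah + v *\<^sub>R Ah') (u *\<^sub>R Bh + v *\<^sub>R Bh') (u *\<^sub>R Ch + v *\<^sub>R Ch') a b
      = u * lmi_drift X Y Ah Bh Ch a b + v * lmi_drift X' Y' Ah' Bh' Ch' a b" for a b
  proof -
    have ba: "b \<bullet> (A *v a) = u * (b \<bullet> (A *v a)) + v * (b \<bullet> (A *v a))" by (simp add: v algebra_simps)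
    show ?thesis
      unfolding lmi_drift_def lin
      by (subst ba) (simp add: matrix_vector_right_distrib matrix_vector_mult_scaleR inner_add_right ring_distribs)
  qed
  have noise: "lmi_noise (u *\<^sub>R Y + v *\<^sub>R Y') (u *\<^sub>R Bh + v *\<^sub>R Bh') a b = u *\<^sub>R lmi_noise Y Bh a b + v *\<^sub>R lmi_noise Y' Bh' a b" for a b
  proof -
    have "u *\<^sub>R (Y *v a) + v *\<^sub>R (Y' *v a) + b = u *\<^sub>R (Y *v a + b) + v *\<^sub>R (Y' *v a + b)"
      by (simp add: v algebra_simps)
    then show ?thesis
      unfolding lmi_noise_def lin lin' by (simp only: lin'') (simp add: algebra_simps)
  qed
  have out: "lmi_output (u *\<^sub>R X + v *\<^sub>R X') (u *\<^sub>R Ch + v *\<^sub>R Ch') a b = u *\<^sub>R lmi_output X Ch a b + v *\<^sub>R lmi_output X' Ch' a b" for a b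
  proof -
    have "a + (u *\<^sub>R (X *v b) + v *\<^sub>R (X' *v b)) = u *\<^sub>R (a + X *v b) + v *\<^sub>R (a + X' *v b)"
      by (simp add: v algebra_simps)
    then show ?thesis
      unfolding lmi_output_def lin
      by (simp only: matrix_vector_right_distrib matrix_vector_mult_scaleR) (simp add: algebra_simps)
  qed
  have comb: "u * r + v * s < t" if "r < t" "s < t" for r s t :: real
    using uv that by (intro convex_bound_lt)
  obtain g g' where g: "(\<Sum>i\<in>UNIV. g i) < \<gamma>" "\<And>i a b. 2 * (lmi_output X Ch a b $ i) - lmi_gram X Y a b \<le> g i"
    and g': "(\<Sum>i\<in>UNIV. g' i) < \<gamma>" "\<And>i a b. 2 * (lmi_output X' Ch' a b $ i) - lmi_gram X' Y' a b \<le> g' i"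
    using P Q by (auto simp: algebra_simps)
  show "u *\<^sub>R p + v *\<^sub>R q \<in> lmi_set"
    unfolding p q scaleR_Pair add_Pair lmi_set_def mem_Collect_eq prod.case
  proof (intro conjI allI impI exI[of _ "\<lambda>i. u * g i + v * g' i"])
    show "transpose (u *\<^sub>R X + v *\<^sub>R X') = u *\<^sub>R X + v *\<^sub>R X'" "transpose (u *\<^sub>R Y + v *\<^sub>R Y') = u *\<^sub>R Y + v *\<^sub>R Y'"
      using P Q by (simp_all add: transpose_add transpose_scalar)
    show "0 < lmi_gram (u *\<^sub>R X + v *\<^sub>R X') (u *\<^sub>R Y + v *\<^sub>R Y') a b" if "(a, b) \<noteq> 0" for a b
      unfolding gram using comb[of "- lmi_gram X Y a b" 0 "- lmi_gram X' Y' a b"] P Q that by (simp add: zero_prod_def)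
    show "2 * lmi_drift (u *\<^sub>R X + v *\<^sub>R X') (u *\<^sub>R Y + v *\<^sub>R Y') (u *\<^sub>R Ah + v *\<^sub>R Ah') (u *\<^sub>R Bh + v *\<^sub>R Bh') (u *\<^sub>R Ch + v *\<^sub>R Ch') a b
       + (norm (lmi_noise (u *\<^sub>R Y + v *\<^sub>R Y') (u *\<^sub>R Bh + v *\<^sub>R Bh') a b))\<^sup>2 < 0" if "(a, b) \<noteq> 0" for a b
    proof -
      let ?r = "2 * lmi_drift X Y Ah Bh Ch a b + (norm (lmi_noise Y Bh a b))\<^sup>2"
      let ?s = "2 * lmi_drift X' Y' Ah' Bh' Ch' a b + (norm (lmi_noise Y' Bh' a b))\<^sup>2"
      have "u * ?r + v * ?s < 0" using P Q that by (intro comb) (auto simp: zero_prod_def)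
      then show ?thesis
        unfolding drift noise
        using norm_power2_convex[OF uv, of "lmi_noise Y Bh a b" "lmi_noise Y' Bh' a b"]
        by (simp add: algebra_simps)
    qed
    show "(\<Sum>i\<in>UNIV. u * g i + v * g' i) < \<gamma>"
      using comb[OF g(1) g'(1)] by (simp add: sum.distrib sum_distrib_left)
    fix i a b
    have "u * (2 * (lmi_output X Ch a b $ i) - lmi_gram X Y a b) + v * (2 * (lmi_output X' Ch' a b $ i) - lmi_gram X' Y' a b)
        \<le> u * g i + v * g' i"
      using uv by (intro add_mono mult_left_mono g(2) g'(2))
    then show "2 * (lmi_output (u *\<^sub>R X + v *\<^sub>R X') (u *\<^sub>R Ch + v *\<^sub>R Ch') a b $ i)
        - lmi_gram (u *\<^sub>R X + v *\<^sub>R X') (u *\<^sub>R Y + v *\<^sub>R Y') a b \<le> u * g i + v * g' i"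
      unfolding out gram by (simp add: algebra_simps)
  qed
qed

lemma sym_inner: "transpose M = M \<Longrightarrow> x \<bullet> (M *v y) = (M *v x) \<bullet> (y :: real^'k)"
  by (metis inner_matrix_vector_right)

text \<open>Congruence by \<open>\<Pi> = [Y -Y; I 0]\<close> makes every closed-loop block affine in the new variables:
  \<open>lmi_gram\<close>, \<open>lmi_drift\<close>, \<open>lmi_noise\<close> and \<open>lmi_output\<close> come from \<open>\<Pi> P \<Pi>\<^sup>T\<close>, \<open>\<Pi> A\<^sub>c\<^sub>l P \<Pi>\<^sup>T\<close>,
  \<open>\<Pi> B\<^sub>c\<^sub>l\<close> and \<open>C\<^sub>c\<^sub>l P \<Pi>\<^sup>T\<close>, evaluated at \<open>(a, b)\<close>.\<close>

lemma cert_iff_lmi: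
  assumes X: "transpose X = X" and Y: "transpose Y = Y" and YS: "(X - Z) ** Y = mat 1"
    and Z: "transpose Z = Z"
    and Ch: "Ch = Kc ** Z" and Bh: "Bh = Y ** L"
    and Ah: "Ah = Y ** (A ** X + B2 ** Ch - L ** C2 ** X - AK ** Z)"
  shows "cert (blk 0 Kc L AK) (blk X Z Z Z) \<longleftrightarrow> (X, Y, Ah, Bh, Ch) \<in> lmi_set"
proof -
  let ?K = "blk 0 Kc L AK" and ?P = "blk X Z Z Z"
  \<comment> \<open>\<open>x a b\<close> is \<Pi>^T applied to (a, b); since \<Pi> is invertible,
    these are all closed-loop vectors.\<close>
  define x where "x a b = pairv (Y *v a + b) (- (Y *v a))" for a b
  have XZ: "X *v (Y *v a) - Z *v (Y *v a) = a" for a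
    using YS by (metis matrix_vector_mul_assoc matrix_vector_mul_lid matrix_vector_mult_diff_rdistrib)
  have YS': "Y ** (X - Z) = mat 1" using YS matrix_left_right_inverse by blast
  have neg: "M *v (- y) = - (M *v y)" for M :: "real^'k^'l" and y
    by (simp add: linear_neg)
  \<comment> \<open>The equal blocks Z of the certificate pay off here: (X - Z) Y = I in the upper
    part, and the Y terms cancel in the lower part.\<close>
  have Px: "?P *v x a b = pairv (a + X *v b) (Z *v b)" for a b
    using XZ[of a] by (simp add: x_def neg matrix_vector_right_distrib algebra_simps)
  have gram: "x a b \<bullet> (?P *v x a b) = lmi_gram X Y a b" for a b
  proof -
    have "a \<bullet> b + (Y *v a) \<bullet> (Z *v b) = (Y *v a) \<bullet> (X *v b)"
      using XZ[of a] sym_inner[OF X, of "Y *v a" b] sym_inner[OF Z, of "Y *v a" b]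
      by (simp add: algebra_simps flip: inner_add_left)
    then show ?thesis
      unfolding Px unfolding x_def lmi_gram_def
      by (simp add: inner_add_left inner_add_right inner_commute)
  qed
  have ah: "a \<bullet> (Ah *v b) = (Y *v a) \<bullet> (A *v (X *v b)) + (Y *v a) \<bullet> (B2 *v (Ch *v b))
      - (Y *v a) \<bullet> (L *v (C2 *v (X *v b))) - (Y *v a) \<bullet> (AK *v (Z *v b))" for a b
    unfolding Ah matrix_vector_mul_assoc[symmetric] sym_inner[OF Y, of a]
    by (simp add: matrix_vector_mult_add_rdistrib matrix_vector_mult_diff_rdistrib inner_add_right inner_diff_right
        flip: matrix_vector_mul_assoc)
  have drift: "x a b \<bullet> (Acl A B2 C2 ?K *v (?P *v x a b)) = lmi_drift X Y Ah Bh Ch a b" for a b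
    unfolding Px closed_loop_blk lmi_drift_def ah
    unfolding x_def Bh Ch matrix_vector_mul_assoc[symmetric] sym_inner[OF Y, of a]
    by (simp add: matrix_vector_right_distrib inner_add_left inner_add_right flip: matrix_vector_mul_assoc)
  have aY: "a v* Y = Y *v a" for a
    using Y by (metis transpose_matrix_vector)
  have noise: "x a b v* Bcl B2 B1 D21 ?K = lmi_noise Y Bh a b" for a b
  proof -
    have vneg: "(- y) v* M = - (y v* M)" for M :: "real^'k^'l" and y
      by (simp add: vec_eq_iff vector_matrix_mult_def sum_negf)
    show ?thesis
      by (simp add: vneg closed_loop_blk x_def lmi_noise_def Bh aY flip: vector_matrix_mul_assoc)
  qed
  have row: "(M ** N) $ i = M $ i v* N" for M :: "real^'k^'l" and N :: "real^'m^'k" and i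
    by (simp add: vec_eq_iff matrix_matrix_mult_def vector_matrix_mult_def mult.commute)
  have out: "Ccl C1 D12 C2 ?K $ i \<bullet> (?P *v x a b) = lmi_output X Ch a b $ i" for a b i
    unfolding Px closed_loop_blk lmi_output_def Ch
    by (simp add: row dot_lmul_matrix matrix_vector_mul_component
        flip: matrix_vector_mul_assoc)
  have surj: "\<exists>a b. y = x a b" for y
  proof -
    obtain c d where y: "y = pairv c d" by (rule pairv_cases)
    have "Y *v ((X - Z) *v d) = d" by (simp add: matrix_vector_mul_assoc YS')
    then have "y = x (- ((X - Z) *v d)) (c + d)" by (simp add: y x_def neg)
    then show ?thesis by blast
  qed
  have Ynz: "Y *v a = 0 \<longleftrightarrow> a = 0" for a
    using XZ[of a] by auto
  have nz: "x a b \<noteq> 0 \<longleftrightarrow> (a, b) \<noteq> 0" for a b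
    by (auto simp: x_def Ynz zero_prod_def)
  have all: "(\<forall>y. y \<noteq> 0 \<longrightarrow> F y) \<longleftrightarrow> (\<forall>a b. (a, b) \<noteq> 0 \<longrightarrow> F (x a b))" for F
    using surj nz by metis
  let ?c = "\<lambda>i. Ccl C1 D12 C2 ?K $ i"
  have Psym: "transpose ?P = ?P" by (simp add: transpose_blk X Z)
  \<comment> \<open>c \<bullet> P c is the maximum over y of 2 (c \<bullet> P y) - y \<bullet> P y:
    one direction expands the form at c - y, the other takes y = c.\<close>
  have cost: "(\<Sum>i\<in>UNIV. ?c i \<bullet> (?P *v ?c i)) < \<gamma> \<longleftrightarrow>
      (\<exists>g. (\<Sum>i\<in>UNIV. g i) < \<gamma> \<and> (\<forall>i a b. 2 * (lmi_output X Ch a b $ i) - lmi_gram X Y a b \<le> g i))"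
    if pos: "\<forall>y. y \<noteq> 0 \<longrightarrow> 0 < y \<bullet> (?P *v y)"
  proof
    assume "(\<Sum>i\<in>UNIV. ?c i \<bullet> (?P *v ?c i)) < \<gamma>"
    moreover have "2 * (lmi_output X Ch a b $ i) - lmi_gram X Y a b \<le> ?c i \<bullet> (?P *v ?c i)" for i a b
    proof -
      let ?d = "?c i - x a b"
      have "0 \<le> ?d \<bullet> (?P *v ?d)" using pos by (cases "?d = 0") (auto intro: less_imp_le)
      moreover have "x a b \<bullet> (?P *v ?c i) = ?c i \<bullet> (?P *v x a b)"
        by (subst sym_inner[OF Psym]) (rule inner_commute)
      ultimately show ?thesis
        unfolding out[symmetric] gram[symmetric] matrix_vector_mult_diff_distrib inner_diff_left inner_diff_right
        by linarith
    qed
    ultimately show "\<exists>g. (\<Sum>i\<in>UNIV. g i) < \<gamma> \<and> (\<forall>i a b. 2 * (lmi_output X Ch a b $ i) - lmi_gram X Y a b \<le> g i)"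
      by blast
  next
    assume "\<exists>g. (\<Sum>i\<in>UNIV. g i) < \<gamma> \<and> (\<forall>i a b. 2 * (lmi_output X Ch a b $ i) - lmi_gram X Y a b \<le> g i)"
    then obtain g where g: "(\<Sum>i\<in>UNIV. g i) < \<gamma>" "\<And>i a b. 2 * (lmi_output X Ch a b $ i) - lmi_gram X Y a b \<le> g i"
      by blast
    have "?c i \<bullet> (?P *v ?c i) \<le> g i" for i
    proof -
      obtain a b where ab: "?c i = x a b" using surj by blast
      have "2 * (?c i \<bullet> (?P *v x a b)) - x a b \<bullet> (?P *v x a b) \<le> g i"
        using g(2)[of a b i] unfolding out gram .
      then show ?thesis by (simp add: ab)
    qed
    then have "(\<Sum>i\<in>UNIV. ?c i \<bullet> (?P *v ?c i)) \<le> (\<Sum>i\<in>UNIV. g i)" by (rule sum_mono)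
    then show "(\<Sum>i\<in>UNIV. ?c i \<bullet> (?P *v ?c i)) < \<gamma>" using g(1) by linarith
  qed
  have "cert ?K ?P \<longleftrightarrow> (\<forall>y. y \<noteq> 0 \<longrightarrow> 0 < y \<bullet> (?P *v y)) \<and>
      (\<forall>y. y \<noteq> 0 \<longrightarrow> 2 * (y \<bullet> (Acl A B2 C2 ?K *v (?P *v y))) + (norm (y v* Bcl B2 B1 D21 ?K))\<^sup>2 < 0) \<and>
      (\<exists>g. (\<Sum>i\<in>UNIV. g i) < \<gamma> \<and> (\<forall>i a b. 2 * (lmi_output X Ch a b $ i) - lmi_gram X Y a b \<le> g i))"
    unfolding cert_def lyap_certificate_def pd_def using cost Psym by blast
  then show ?thesis
    unfolding all gram drift noise lmi_set_def using X Y by simp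
qed

end

lemma transpose_matrix_inv:
  fixes M :: "real^'n^'n"
  assumes "transpose M = M" "det M \<noteq> 0" shows "transpose (matrix_inv M) = matrix_inv M"
proof -
  have "M ** transpose (matrix_inv M) = mat 1"
    using matrix_inv_left[OF assms(2)] assms(1) by (metis matrix_transpose_mul transpose_mat)
  then show ?thesis using matrix_inv_unique_right(1) by metis
qed

lemma det_matrix_inv_nz: "det (M :: real^'n^'n) \<noteq> 0 \<Longrightarrow> det (matrix_inv M) \<noteq> 0"
  using matrix_inv_unique_right(2)[OF matrix_inv_left] .

context plant
begin

text \<open>Definiteness of [Y I; I X] passes to the block Y and to its Schur complement X -
  Y^-1.\<close>

lemma lmi_set_det_nz:
  assumes "(X, Y, Ah, Bh, Ch) \<in> lmi_set"
  shows "det Y \<noteq> 0" "det (X - matrix_inv Y) \<noteq> 0"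
proof -
  have sym: "transpose Y = Y" and pos: "\<And>a b. (a, b) \<noteq> 0 \<Longrightarrow> 0 < lmi_gram X Y a b"
    using assms by (auto simp: lmi_set_def)
  show nz: "det Y \<noteq> 0"
  proof (rule det_nz_if_inj)
    fix a assume "Y *v a = 0"
    then show "a = 0" using pos[of a 0] by (auto simp: lmi_gram_def zero_prod_def)
  qed
  show "det (X - matrix_inv Y) \<noteq> 0"
  proof (rule det_nz_if_inj)
    fix b assume b: "(X - matrix_inv Y) *v b = 0"
    \<comment> \<open>The minimizer of the form in \<open>a\<close> for fixed \<open>b\<close>, at
      which the form reduces to the Schur complement.\<close>
    define a where "a = - (matrix_inv Y *v b)"
    have "Y *v a = - b"
      by (simp add: a_def linear_neg matrix_vector_mul_assoc matrix_inv_right[OF nz])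
    moreover have "X *v b = - a"
      using b by (simp add: a_def matrix_vector_mult_diff_rdistrib)
    ultimately have "lmi_gram X Y a b = 0"
      by (simp add: lmi_gram_def inner_commute)
    then show "b = 0" using pos[of a b] by (auto simp: zero_prod_def)
  qed
qed

text \<open>The change of variables is invertible: Y = (X - Z)^-1 recovers Z as X - Y^-1, and Y and
  Z are invertible on both sides.\<close>

lemma normalized_eq_image: "normalized = controller_of_lmi ` lmi_set"
proof (intro set_eqI iffI)
  fix K assume "K \<in> controller_of_lmi ` lmi_set"
  then obtain p where p: "p \<in> lmi_set" "K = controller_of_lmi p" by blast
  obtain X Y Ah Bh Ch where "p = (X, Y, Ah, Bh, Ch)" by (rule prod_cases5)
  with p have lmi: "(X, Y, Ah, Bh, Ch) \<in> lmi_set" and K: "K = controller_of_lmi (X, Y, Ah, Bh, Ch)"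
    by simp_all
  define S Z where "S = matrix_inv Y" and "Z = X - S"
  note nz = lmi_set_det_nz[OF lmi, folded S_def, folded Z_def]
  have sym: "transpose X = X" "transpose Y = Y" using lmi by (auto simp: lmi_set_def)
  have S: "S ** Y = mat 1" "Y ** S = mat 1" "transpose S = S"
    using matrix_inv_left[OF nz(1)] matrix_inv_right[OF nz(1)] transpose_matrix_inv[OF sym(2) nz(1)]
    by (simp_all add: S_def)
  have symZ: "transpose Z = Z"
    using sym(1) S(3) by (simp add: Z_def transpose_def vec_eq_iff)
  have ZZ: "M ** matrix_inv Z ** Z = M" for M :: "real^'n^'l"
    by (simp add: matrix_inv_left[OF nz(2)] flip: matrix_mul_assoc)
  have YS: "Y ** S ** M = M" for M :: "real^'l^'n" by (simp add: S)
  let ?AK = "(A ** X + B2 ** Ch - S ** Bh ** C2 ** X - S ** Ah) ** matrix_inv Z"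
  have K': "K = blk 0 (Ch ** matrix_inv Z) (S ** Bh) ?AK"
    by (simp add: K controller_of_lmi_def Let_def S_def Z_def)
  have "cert K (blk X Z Z Z)"
    unfolding K'
  proof (subst cert_iff_lmi)
    show "(X, Y, Ah, Bh, Ch) \<in> lmi_set" by (rule lmi)
    show "(X - Z) ** Y = mat 1" by (simp add: Z_def S)
    show "Ch = Ch ** matrix_inv Z ** Z" "Bh = Y ** (S ** Bh)"
      by (simp_all add: ZZ YS matrix_mul_assoc)
    have "A ** X + B2 ** Ch - S ** Bh ** C2 ** X - ?AK ** Z = S ** Ah"
      unfolding ZZ by simp
    then show "Ah = Y ** (A ** X + B2 ** Ch - S ** Bh ** C2 ** X - ?AK ** Z)"
      by (simp add: YS matrix_mul_assoc)
  qed (use sym symZ in auto)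
  moreover have "DKof K = 0" by (simp add: K')
  ultimately show "K \<in> normalized" unfolding normalized_def by blast
next
  fix K assume "K \<in> normalized"
  then obtain X Z where D: "DKof K = 0" and cert: "cert K (blk X Z Z Z)"
    unfolding normalized_def by blast
  define Kc L AK where "Kc = CKof K" and "L = BKof K" and "AK = AKof K"
  have K: "K = blk 0 Kc L AK"
    using controller_eq_blk[of K] by (simp add: D Kc_def L_def AK_def)
  have pd: "pd (blk X Z Z Z)" using cert by (simp add: cert_def lyap_certificate_def)
  then have sym: "transpose X = X" "transpose Z = Z"
    by (simp_all add: pd_def transpose_blk)
  have pos: "0 < x \<bullet> (blk X Z Z Z *v x)" if "x \<noteq> 0" for x using pd that by (simp add: pd_def)
  define S Y where "S = X - Z" and "Y = matrix_inv S"
  have symS: "transpose S = S" using sym by (simp add: S_def transpose_def vec_eq_iff)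
  \<comment> \<open>Testing the certificate at (b, -b) isolates X - Z; testing it at (0, b) isolates
    Z.\<close>
  have nzS: "det S \<noteq> 0"
  proof (rule det_nz_if_inj)
    fix b assume b: "S *v b = 0"
    have "Z *v (- b) = - (Z *v b)" by (simp add: linear_neg)
    then show "b = 0"
      using pos[of "pairv b (- b)"] b by (force simp: S_def matrix_vector_mult_diff_rdistrib)
  qed
  have nzZ: "det Z \<noteq> 0"
  proof (rule det_nz_if_inj)
    fix b assume "Z *v b = 0"
    then show "b = 0" using pos[of "pairv 0 b"] by auto
  qed
  have SY: "S ** Y = mat 1" "Y ** S = mat 1"
    by (simp_all add: Y_def matrix_inv_left matrix_inv_right nzS)
  have YS: "matrix_inv Y = S" using matrix_inv_unique_right(1)[OF SY(2)] .
  define Ch Bh where "Ch = Kc ** Z" and "Bh = Y ** L"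
  define Ah where "Ah = Y ** (A ** X + B2 ** Ch - L ** C2 ** X - AK ** Z)"
  have "(X, Y, Ah, Bh, Ch) \<in> lmi_set"
    using cert unfolding K
    by (subst (asm) cert_iff_lmi[OF sym(1) _ _ sym(2) Ch_def Bh_def Ah_def])
       (use SY transpose_matrix_inv[OF symS nzS] in \<open>simp_all add: S_def Y_def\<close>)
  moreover have "controller_of_lmi (X, Y, Ah, Bh, Ch) = K"
  proof -
    have SYM: "S ** (Y ** M) = M" for M :: "real^'l^'n" by (simp add: matrix_mul_assoc SY)
    have Z: "X - S = Z" by (simp add: S_def)
    have ZZ: "M ** Z ** matrix_inv Z = M" for M :: "real^'n^'l"
      by (simp add: matrix_inv_right[OF nzZ] flip: matrix_mul_assoc)
    have SAh: "S ** Ah = A ** X + B2 ** Ch - L ** C2 ** X - AK ** Z"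
      by (simp add: Ah_def SYM)
    have SBh: "S ** Bh = L" by (simp add: Bh_def SYM)
    show ?thesis
      unfolding controller_of_lmi_def prod.case Let_def YS Z SAh SBh K
      by (simp add: ZZ Ch_def)
  qed
  ultimately show "K \<in> controller_of_lmi ` lmi_set" by (metis image_eqI)
qed

lemma continuous_on_blk:
  assumes "continuous_on S f" "continuous_on S g" "continuous_on S h" "continuous_on S k"
  shows "continuous_on S (\<lambda>x. blk (f x :: real^'a^'b) (g x :: real^'c^'b) (h x :: real^'a^'d) (k x :: real^'c^'d))"
proof (rule continuous_on_matrixI)
  fix i j
  show "continuous_on S (\<lambda>x. blk (f x) (g x) (h x) (k x) $ i $ j)"
    by (cases i; cases j) (auto intro!: continuous_intros assms)
qed

lemma continuous_on_controller_of_lmi: "continuous_on lmi_set controller_of_lmi"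
proof -
  have eq: "controller_of_lmi p = (let X = fst p; Y = fst (snd p); Ah = fst (snd (snd p));
      Bh = fst (snd (snd (snd p))); Ch = snd (snd (snd (snd p))); S = matrix_inv Y; Z' = matrix_inv (X - S) in
     blk 0 (Ch ** Z') (S ** Bh) ((A ** X + B2 ** Ch - S ** Bh ** C2 ** X - S ** Ah) ** Z'))" for p
    by (simp add: controller_of_lmi_def split_beta Let_def)
  have nz: "det (fst (snd p)) \<noteq> 0" "det (fst p - matrix_inv (fst (snd p))) \<noteq> 0" if "p \<in> lmi_set" for p
    using lmi_set_det_nz that by (metis prod.collapse)+
  show ?thesis
    unfolding eq Let_def
    by (intro continuous_on_blk continuous_intros) (auto simp: nz)
qed

lemma path_connected_normalized: "path_connected normalized"
  unfolding normalized_eq_image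
  by (intro path_connected_continuous_image continuous_on_controller_of_lmi
      convex_imp_path_connected convex_lmi_set)

section \<open>Action of coordinate changes on certified controllers\<close>

lemma simT_blk: "simT T (blk 0 Kc L AK) = blk 0 (Kc ** matrix_inv T) (T ** L) (T ** AK ** matrix_inv T)"
  by (simp add: simT_def)

text \<open>Changing the controller coordinates is a closed-loop similarity by diag(I, T), which
  leaves the plant state alone.\<close>

lemma cert_simT:
  fixes T :: "real^'n^'n"
  assumes T: "det T \<noteq> 0" and D: "DKof K = 0" and cert: "cert K P"
  shows "cert (simT T K) (blk (mat 1) 0 0 T ** P ** transpose (blk (mat 1) 0 0 T))"
proof -
  define Kc L AK where "Kc = CKof K" and "L = BKof K" and "AK = AKof K"
  have K: "K = blk 0 Kc L AK"
    using controller_eq_blk[of K] by (simp add: D Kc_def L_def AK_def)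
  let ?U = "blk (mat 1) 0 0 T" and ?U' = "blk (mat 1) 0 0 (matrix_inv T)"
  have "?U' ** ?U = mat 1" by (simp add: blk_mult matrix_inv_left[OF T] blk_one)
  from lyap_certificate_similarity[OF cert[unfolded cert_def K closed_loop_blk] this]
  show ?thesis
    unfolding cert_def K simT_blk closed_loop_blk
    by (simp add: blk_mult blk_mult_vcat hcat_mult_blk matrix_mul_assoc)
qed

lemma simT_certified: "det T \<noteq> 0 \<Longrightarrow> K \<in> certified \<Longrightarrow> simT T K \<in> certified"
  using cert_simT unfolding certified_def by (auto simp: simT_def)

lemma normalized_subset: "normalized \<subseteq> certified"
  unfolding normalized_def certified_def by blast

lemma simT_simT:
  fixes T U :: "real^'n^'n"
  assumes "det T \<noteq> 0" "det U \<noteq> 0"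
  shows "simT T (simT U K) = simT (T ** U) (K :: real^('y + 'n)^('u + 'n))"
proof -
  have "(T ** U) ** (matrix_inv U ** matrix_inv T) = mat 1"
    using assms by (metis matrix_inv_right matrix_mul_assoc matrix_mul_rid)
  then have "matrix_inv (T ** U) = matrix_inv U ** matrix_inv T"
    by (rule matrix_inv_unique_right)
  then show ?thesis by (simp add: simT_def matrix_mul_assoc)
qed

lemma simT_one: "simT (mat 1 :: real^'n^'n) K = (K :: real^('y + 'n)^('u + 'n))"
proof -
  have "matrix_inv (mat 1 :: real^'n^'n) = mat 1" by (rule matrix_inv_unique_right) simp
  then show ?thesis using controller_eq_blk[of K] by (simp add: simT_def)
qed

lemma simT_inverse:
  fixes T :: "real^'n^'n"
  assumes "det T \<noteq> 0"
  shows "simT (matrix_inv T) (simT T K) = (K :: real^('y + 'n)^('u + 'n))"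
    "simT T (simT (matrix_inv T) K) = K"
  using simT_simT[OF det_matrix_inv_nz[OF assms] assms] simT_simT[OF assms det_matrix_inv_nz[OF assms]]
  by (simp_all add: matrix_inv_left matrix_inv_right assms simT_one)

lemma certified_eq:
  "certified = (\<lambda>(T, K). simT T K) ` ({T. det T \<noteq> 0} \<times> normalized)"
proof (intro set_eqI iffI)
  fix K assume "K \<in> certified"
  then obtain P where D: "DKof K = 0" and cert: "cert K P" unfolding certified_def by blast
  \<comment> \<open>Symmetric, and moves only the off-diagonal blocks, by multiples of the
    identity.\<close>
  define E :: "real^('n + 'n)^('n + 'n)" where "E = blk 0 (mat 1) (mat 1) 0"
  have "transpose E = E" by (rule blk_eqI) (simp_all add: E_def transpose_def mat_def)
  from eventually_lyap_certificate_perturb[OF cert[unfolded cert_def] this]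
  have ev: "\<forall>\<^sub>F t in at_right 0. cert K (P + t *\<^sub>R E)" by (simp add: cert_def)
  obtain X M N Z where P: "P = blk X M N Z" by (rule blk_cases)
  from ev eventually_det_shift_nz[of M]
  have "\<forall>\<^sub>F t in at_right 0. cert K (P + t *\<^sub>R E) \<and> det (M + t *\<^sub>R mat 1) \<noteq> 0"
    by (rule eventually_conj)
  then obtain t where t: "cert K (P + t *\<^sub>R E)" "det (M + t *\<^sub>R mat 1) \<noteq> 0"
    using eventually_happens' trivial_limit_at_right_real by blast
  define M' N' where "M' = M + t *\<^sub>R mat 1" and "N' = N + t *\<^sub>R mat 1"
  have c: "cert K (blk X M' N' Z)"
    using t(1) unfolding P E_def blk_add_scaleR by (simp add: M'_def N'_def)
  have nzM: "det M' \<noteq> 0" using t(2) by (simp add: M'_def)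
  have pd: "pd (blk X M' N' Z)" using c by (simp add: cert_def lyap_certificate_def)
  then have N': "N' = transpose M'" and symZ: "transpose Z = Z"
    by (auto simp: pd_def transpose_blk)
  have pos: "0 < x \<bullet> (blk X M' N' Z *v x)" if "x \<noteq> 0" for x using pd that by (simp add: pd_def)
  have nzZ: "det Z \<noteq> 0"
  proof (rule det_nz_if_inj)
    fix b assume "Z *v b = 0"
    then show "b = 0" using pos[of "pairv 0 b"] by auto
  qed
  \<comment> \<open>Dictated by T Z = M': then the transformed blocks M' T^T and T Z T^T agree.
    Invertibility of M' makes it a legitimate coordinate change.\<close>
  define T where "T = M' ** matrix_inv Z"
  have T: "det T \<noteq> 0" by (simp add: T_def det_mul nzM det_matrix_inv_nz[OF nzZ])
  define W where "W = M' ** matrix_inv Z ** transpose M'"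
  have tT: "transpose T = matrix_inv Z ** transpose M'"
    by (simp add: T_def matrix_transpose_mul transpose_matrix_inv[OF symZ nzZ])
  have "transpose (0 :: real^'n^'n) = 0" by (simp add: transpose_def vec_eq_iff)
  then have "blk (mat 1) 0 0 T ** blk X M' N' Z ** transpose (blk (mat 1) 0 0 T) =
      blk X (M' ** transpose T) (T ** N') (T ** Z ** transpose T)"
    by (simp add: transpose_blk blk_mult)
  also have "\<dots> = blk X W W W"
  proof -
    have "T ** Z = M'" by (simp add: T_def matrix_inv_left[OF nzZ] flip: matrix_mul_assoc)
    then show ?thesis by (simp add: tT W_def N') (simp add: T_def matrix_mul_assoc)
  qed
  finally have "cert (simT T K) (blk X W W W)" using cert_simT[OF T D c] by simp
  then have "simT T K \<in> normalized"
    unfolding normalized_def using D by (auto simp: simT_def)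
  moreover have "K = simT (matrix_inv T) (simT T K)" by (simp add: simT_inverse[OF T])
  ultimately show "K \<in> (\<lambda>(T, K). simT T K) ` ({T. det T \<noteq> 0} \<times> normalized)"
    using det_matrix_inv_nz[OF T] by (auto intro!: image_eqI[of _ _ "(matrix_inv T, simT T K)"])
qed (use simT_certified normalized_subset in auto)

definition half :: "(real^'n^'n) set \<Rightarrow> (real^('y + 'n)^('u + 'n)) set" where
  "half D = (\<lambda>(T, K). simT T K) ` (D \<times> normalized)"

lemma continuous_on_of_blocks [continuous_intros]:
  assumes "continuous_on S f"
  shows "continuous_on S (\<lambda>x. DKof (f x :: real^('y + 'n)^('u + 'n)))" "continuous_on S (\<lambda>x. CKof (f x :: real^('y + 'n)^('u + 'n)))"
    "continuous_on S (\<lambda>x. BKof (f x :: real^('y + 'n)^('u + 'n)))" "continuous_on S (\<lambda>x. AKof (f x :: real^('y + 'n)^('u + 'n)))"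
  unfolding DKof_def CKof_def BKof_def AKof_def by (intro continuous_intros assms)+

lemma path_connected_half:
  assumes "path_connected D" "\<And>T. T \<in> D \<Longrightarrow> det T \<noteq> 0"
  shows "path_connected (half D)"
  unfolding half_def
proof (rule path_connected_continuous_image)
  show "continuous_on (D \<times> normalized) (\<lambda>(T, K). simT T K)"
    unfolding simT_def split_beta
    by (intro continuous_on_blk continuous_intros) (use assms(2) in auto)
qed (intro path_connected_Times assms path_connected_normalized)

lemma simT_half:
  assumes T: "det T \<noteq> 0" and D: "\<And>U. U \<in> D \<Longrightarrow> det U \<noteq> 0" "\<And>U. U \<in> D \<Longrightarrow> T ** U \<in> D'"
  shows "simT T ` half D \<subseteq> half D'"
proof clarify
  fix K assume "K \<in> half D"
  then obtain U K0 where U: "U \<in> D" "K0 \<in> normalized" "K = simT U K0" by (auto simp: half_def)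
  then have "simT T K = simT (T ** U) K0" using simT_simT[OF T D(1)] by simp
  then show "simT T K \<in> half D'" using U D(2)[of U] by (force simp: half_def)
qed

end

text \<open>With D_K = 0 the closed loop has no feedthrough, so the certificate criterion applies to
  the norm.\<close>

lemma sublevel_eq_certified:
  "sublevel A B2 C2 W V Q R \<gamma> = plant.certified A B2 C2 (B1of W V) (D21of W V) (C1of Q R) (D12of Q R) \<gamma>"
proof -
  have "K \<in> sublevel A B2 C2 W V Q R \<gamma> \<longleftrightarrow> DKof K = 0 \<and>
      (\<exists>P. lyap_certificate (Acl A B2 C2 K) (Bcl B2 (B1of W V) (D21of W V) K) (Ccl (C1of Q R) (D12of Q R) C2 K) \<gamma> P)" for K
  proof (cases "DKof K = 0")
    case True
    then have "Dcl (D11of W V R) (D12of Q R) (D21of W V) K = 0"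
      by (simp add: Dcl_def D11of_def)
    with True show ?thesis
      unfolding sublevel_def Cstab_def lqg_h2sq_def hurwitz_h2sq_less_iff_certificate[symmetric] by simp
  qed (simp add: sublevel_def)
  then show ?thesis
    unfolding plant.certified_def plant.cert_def by blast
qed

section \<open>Path components of the sublevel set\<close>

lemma linear_simT:
  fixes T :: "real^'n^'n"
  shows "linear (simT T :: real^('y::finite + 'n)^('u::finite + 'n) \<Rightarrow> _)"
proof (rule linearI)
  fix K K' :: "real^('y + 'n)^('u + 'n)" and c :: real
  have add: "DKof (K + K') = DKof K + DKof K'" "CKof (K + K') = CKof K + CKof K'"
    "BKof (K + K') = BKof K + BKof K'" "AKof (K + K') = AKof K + AKof K'"
    and scale: "DKof (c *\<^sub>R K) = c *\<^sub>R DKof K" "CKof (c *\<^sub>R K) = c *\<^sub>R CKof K"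
    "BKof (c *\<^sub>R K) = c *\<^sub>R BKof K" "AKof (c *\<^sub>R K) = c *\<^sub>R AKof K"
    by (simp_all add: DKof_def CKof_def BKof_def AKof_def vec_eq_iff)
  show "simT T (K + K') = simT T K + simT T K'"
    unfolding simT_def add matrix_add_ldistrib matrix_add_rdistrib
    by (rule blk_eqI) simp_all
  show "simT T (c *\<^sub>R K) = c *\<^sub>R simT T K"
    unfolding simT_def scale matrix_mult_scaleR_left matrix_mult_scaleR_right
    by (rule blk_eqI) simp_all
qed

text \<open>The first directional derivative is constant and all later ones vanish, so every
  iterated derivative is the map itself or a constant.\<close>

lemma smooth_on_bounded_linear:
  assumes "bounded_linear f" shows "smooth_on S f"
proof -
  have f: "(f has_derivative f) (at x)" for x
    using assms by (rule bounded_linear_imp_has_derivative)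
  have "dder vs f = f \<or> (\<exists>c. dder vs f = (\<lambda>x. c))" for vs
  proof (induction vs)
    case (Cons v vs)
    have "frechet_derivative f (at x) = f" for x
      using frechet_derivative_at[OF f] by simp
    then have "dder (v # vs) f = (\<lambda>x. f v)" if "dder vs f = f" using that by simp
    moreover have "dder (v # vs) f = (\<lambda>x. 0)" if "dder vs f = (\<lambda>x. c)" for c using that by simp
    ultimately show ?case using Cons by blast
  qed simp
  then have "dder vs f differentiable (at x)" for vs x
    using f unfolding differentiable_def by (metis has_derivative_const)
  then show ?thesis by (simp add: smooth_on_def)
qed

text \<open>A component contains each piece it meets. Two components therefore cannot share a piece,
  and each must equal the one it contains. Overlapping or empty pieces only lower the count.\<close>

lemma path_components_cover2:
  fixes S H H' :: "'a::topological_space set"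
  assumes S: "S = H \<union> H'" and H: "path_connected H" "path_connected H'"
  defines "\<C> \<equiv> path_components_of (top_of_set S)"
  shows "finite \<C> \<and> card \<C> \<le> 2"
    and "\<And>L L'. \<C> = {L, L'} \<Longrightarrow> L \<noteq> L' \<Longrightarrow> L = H \<and> L' = H' \<or> L = H' \<and> L' = H"
proof -
  have max: "G \<subseteq> C" if "C \<in> \<C>" "G \<inter> C \<noteq> {}" "G = H \<or> G = H'" for C G
  proof (rule path_components_of_maximal)
    show "path_connectedin (top_of_set S) G"
      using that(3) S H by (auto simp: path_connectedin_subtopology)
  qed (use that in \<open>auto simp: \<C>_def disjnt_def\<close>)
  have sub: "C \<subseteq> S" "C \<noteq> {}" if "C \<in> \<C>" for C
    using that path_components_of_subset nonempty_path_components_of unfolding \<C>_def by fastforce+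
  have disj: "C = C'" if "C \<in> \<C>" "C' \<in> \<C>" "C \<inter> C' \<noteq> {}" for C C'
    using that path_components_of_overlap unfolding \<C>_def by blast
  \<comment> \<open>A component is determined by one bit, whether it meets \<open>H\<close>.\<close>
  have inj: "inj_on (\<lambda>C. H \<inter> C \<noteq> {}) \<C>"
  proof (rule inj_onI)
    fix C C' assume C: "C \<in> \<C>" "C' \<in> \<C>" and eq: "(H \<inter> C \<noteq> {}) = (H \<inter> C' \<noteq> {})"
    show "C = C'"
    proof (cases "H \<inter> C = {}")
      case True
      then have "H' \<inter> C \<noteq> {}" "H' \<inter> C' \<noteq> {}" using sub[OF C(1)] sub[OF C(2)] eq S by blast+
      then have "H' \<subseteq> C" "H' \<subseteq> C'" using max C by blast+
      then show ?thesis using disj[OF C] \<open>H' \<inter> C \<noteq> {}\<close> by blast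
    next
      case False
      then have "H \<subseteq> C" "H \<subseteq> C'" using max C eq by blast+
      then show ?thesis using disj[OF C] False by blast
    qed
  qed
  have "card \<C> \<le> card (UNIV :: bool set)"
    by (rule card_inj_on_le[OF inj]) auto
  moreover have "finite \<C>" by (rule inj_on_finite[OF inj, of UNIV]) auto
  ultimately show "finite \<C> \<and> card \<C> \<le> 2" by (simp add: card_UNIV_bool)
  have one: "C = H \<and> C' = H'" if C: "C \<in> \<C>" "C' \<in> \<C>" "C \<noteq> C'" "H \<inter> C \<noteq> {}" for C C'
  proof -
    have "H \<inter> C' = {}" using inj_onD[OF inj, of C C'] C by blast
    then have C': "C' \<subseteq> H'" "H' \<inter> C' \<noteq> {}" using sub[OF C(2)] S by blast+
    then have "H' = C'" using max[OF C(2)] by blast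
    moreover have "H \<subseteq> C" using max C by blast
    moreover have "C \<inter> C' = {}" using disj C by blast
    ultimately show ?thesis using sub(1)[OF C(1)] S by blast
  qed
  fix L L' assume L: "\<C> = {L, L'}" "L \<noteq> L'"
  then have m: "L \<in> \<C>" "L' \<in> \<C>" by auto
  have "(H \<inter> L \<noteq> {}) \<noteq> (H \<inter> L' \<noteq> {})" using inj_onD[OF inj _ m] L(2) by blast
  then show "L = H \<and> L' = H' \<or> L = H' \<and> L' = H"
    using one[OF m L(2)] one[OF m(2,1) L(2)[symmetric]] by blast
qed

context plant
begin

lemma certified_eq_halves: "certified = half {T. 0 < det T} \<union> half {T. det T < 0}"
proof -
  have "{T :: real^'n^'n. det T \<noteq> 0} = {T. 0 < det T} \<union> {T. det T < 0}" by auto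
  then show ?thesis unfolding certified_eq half_def by (simp add: Sigma_Un_distrib1 image_Un)
qed

lemma diffeo_via_simT:
  fixes T :: "real^'n^'n"
  assumes T: "det T \<noteq> 0" and "simT T ` H \<subseteq> H'" "simT (matrix_inv T) ` H' \<subseteq> H"
  shows "diffeo_via (simT T) (H :: (real^('y + 'n)^('u + 'n)) set) H'"
  unfolding diffeo_via_def
proof (intro exI[of _ "simT (matrix_inv T)"] conjI)
  have lin: "bounded_linear (simT U :: real^('y + 'n)^('u + 'n) \<Rightarrow> _)" for U :: "real^'n^'n"
    using linear_simT by (simp add: linear_conv_bounded_linear)
  show "smooth_on H (simT T)" "smooth_on H' (simT (matrix_inv T))"
    by (intro smooth_on_bounded_linear lin)+
  show "homeomorphism H H' (simT T) (simT (matrix_inv T))"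
    using assms(2,3) simT_inverse[OF T]
    by (intro homeomorphismI linear_continuous_on lin) auto
qed

end

theorem theorem4:
  fixes A :: "real^'n^'n" and B2 :: "real^'u^'n" and C2 :: "real^'n^'y"
    and W :: "real^'n^'n" and V :: "real^'y^'y" and Q :: "real^'n^'n" and R :: "real^'u^'u"
    and \<gamma> :: real
  assumes "psd W" and "pd V" and "psd Q" and "pd R"
    and "controllable A B2" and "controllable A (msqrt W)"
    and "observable C2 A" and "observable (msqrt Q) A"
    and "\<gamma> > 0"
  shows "finite (path_components_of (top_of_set (sublevel A B2 C2 W V Q R \<gamma>)))
       \<and> card (path_components_of (top_of_set (sublevel A B2 C2 W V Q R \<gamma>))) \<le> 2
       \<and> (\<forall>L1 L2. path_components_of (top_of_set (sublevel A B2 C2 W V Q R \<gamma>)) = {L1, L2}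
             \<and> L1 \<noteq> L2 \<longrightarrow>
             (\<forall>T :: real^'n^'n. invertible T \<and> det T < 0 \<longrightarrow> diffeo_via (simT T) L1 L2))"
proof -
  interpret plant A B2 C2 "B1of W V" "D21of W V" "C1of Q R" "D12of Q R" \<gamma> .
  let ?P = "half {T. 0 < det T}" and ?N = "half {T. det T < 0}"
  have S: "sublevel A B2 C2 W V Q R \<gamma> = ?P \<union> ?N"
    by (simp add: sublevel_eq_certified certified_eq_halves)
  have "path_connected ?P" "path_connected ?N"
    by (auto intro!: path_connected_half path_connected_det_pos path_connected_det_neg)
  note comps = path_components_cover2[OF S this]
  \<comment> \<open>Left multiplication by T flips the sign of the determinant; the inverse of T has
    negative determinant too, so it maps the halves back.\<close>
  have swap: "simT T ` ?P \<subseteq> ?N" "simT T ` ?N \<subseteq> ?P" if "det T < 0" for T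
    using that by (intro simT_half; simp add: det_mul mult_neg_pos mult_neg_neg)+
  have "diffeo_via (simT T) ?P ?N" "diffeo_via (simT T) ?N ?P" if T: "det T < 0" for T
  proof -
    have "det T * det (matrix_inv T) = 1"
      using arg_cong[OF matrix_inv_right[of T], of det] T by (simp add: det_mul)
    then have "det (matrix_inv T) < 0"
      using T mult_nonpos_nonneg[of "det T" "det (matrix_inv T)"] by linarith
    then show "diffeo_via (simT T) ?P ?N" "diffeo_via (simT T) ?N ?P"
      using T by (intro diffeo_via_simT swap; simp)+
  qed
  then show ?thesis using comps by metis
qed

end
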